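(* Let $d\in\mathbb{N}$, let $a<b$ be real numbers, let $P_1=P_1^*\in\mathbb{R}^{d\times d}$ be invertible, $P_0=-P_0^*\in\mathbb{R}^{d\times d}$, and let $\mathcal{H}\in L_\infty(a,b;\mathbb{R}^{d\times d})$ satisfy $\mathcal{H}(x)=\mathcal{H}(x)^*\ge m$ for some $m>0$. For $t\in\mathbb{R}$ let $\Phi_t\colon[a,b]\to\mathbb{C}^{d\times d}$ be the fundamental matrix of $$u'(x)=P_1^{-1}\big(\mathrm{i}t\mathcal{H}(x)^{-1}-P_0\big)u(x)\in\mathbb{C}^d\quad(x\in(a,b))$$ with $\Phi_t(a)=1_d$. Assume that $\mathcal{H}$ is of bounded variation. Then $\sup_{t\in\mathbb{R}}\|\Phi_t\|_\infty<\infty$.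
   Context: $1_d$ is the $d\times d$ identity matrix; $\|\Phi_t\|_\infty=\sup_{x\in[a,b]}\|\Phi_t(x)\|$. Inequalities between matrices are in the sense of positive definiteness. The fundamental matrix $\Phi_t$ is the matrix-valued (absolutely continuous) solution of the ODE with the stated initial value. A function $\alpha\in L_1(a,b)$ is of bounded variation if $\sup\{|\int_a^b\alpha(x)\phi'(x)\,\mathrm{d}x|\,;\ \phi\in C_c^1(a,b),\ \|\phi\|_\infty\le1\}<\infty$; a matrix-valued function is of bounded variation if all its components are. *)

theory Defs
  imports "HOL-Analysis.Analysis"
begin

text \<open>
  Elements of the Lebesgue spaces over \<open>(a,b)\<close> are represented by functions on all of \<open>\<real>\<close>;
  only their values almost everywhere on \<open>(a,b)\<close> enter the definitions below.
\<close>

definition Linf_matrix :: "real \<Rightarrow> real \<Rightarrow> (real \<Rightarrow> real ^ 'n ^ 'n) \<Rightarrow> bool" where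
  "Linf_matrix a b H \<longleftrightarrow>
     H \<in> borel_measurable (lebesgue_on {a<..<b}) \<and>
     (\<exists>C. AE x in lebesgue_on {a<..<b}. onorm ((*v) (H x)) \<le> C)"

definition loewner_le :: "real ^ 'n ^ 'n \<Rightarrow> real ^ 'n ^ 'n \<Rightarrow> bool" where
  "loewner_le A B \<longleftrightarrow> (\<forall>v. v \<bullet> (A *v v) \<le> v \<bullet> (B *v v))"

definition C1_compact_support :: "real \<Rightarrow> real \<Rightarrow> (real \<Rightarrow> real) set" where
  "C1_compact_support a b =
     {\<phi>. \<phi> C1_differentiable_on UNIV \<and> closure {x. \<phi> x \<noteq> 0} \<subseteq> {a<..<b}}"

definition bounded_variation :: "real \<Rightarrow> real \<Rightarrow> (real \<Rightarrow> real) \<Rightarrow> bool" where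
  "bounded_variation a b \<alpha> \<longleftrightarrow>
     integrable (lebesgue_on {a<..<b}) \<alpha> \<and>
     (SUP \<phi>\<in>{\<phi> \<in> C1_compact_support a b. \<forall>x. \<bar>\<phi> x\<bar> \<le> 1}.
        ereal \<bar>integral\<^sup>L (lebesgue_on {a<..<b}) (\<lambda>x. \<alpha> x * deriv \<phi> x)\<bar>) < \<infinity>"

definition bounded_variation_matrix :: "real \<Rightarrow> real \<Rightarrow> (real \<Rightarrow> real ^ 'n ^ 'n) \<Rightarrow> bool" where
  "bounded_variation_matrix a b H \<longleftrightarrow> (\<forall>i j. bounded_variation a b (\<lambda>x. H x $ i $ j))"

text \<open>
  The \<open>\<epsilon>\<close>-\<open>\<delta>\<close> definition of absolute continuity; a division of its own union is a finite family of
  compact intervals with pairwise disjoint interiors.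
\<close>

definition abs_continuous_on :: "real \<Rightarrow> real \<Rightarrow> (real \<Rightarrow> 'a::real_normed_vector) \<Rightarrow> bool" where
  "abs_continuous_on a b f \<longleftrightarrow>
     (\<forall>\<epsilon>>0. \<exists>\<delta>>0. \<forall>D. D division_of \<Union>D \<longrightarrow> \<Union>D \<subseteq> {a..b} \<longrightarrow> (\<Sum>K\<in>D. Sup K - Inf K) < \<delta> \<longrightarrow>
        (\<Sum>K\<in>D. norm (f (Sup K) - f (Inf K))) < \<epsilon>)"

definition fundamental_matrix ::
    "real \<Rightarrow> real \<Rightarrow> (real \<Rightarrow> complex ^ 'n ^ 'n) \<Rightarrow> (real \<Rightarrow> complex ^ 'n ^ 'n) \<Rightarrow> bool" where
  "fundamental_matrix a b A \<Phi> \<longleftrightarrow>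
     abs_continuous_on a b \<Phi> \<and>
     (AE x in lebesgue_on {a<..<b}. (\<Phi> has_vector_derivative A x ** \<Phi> x) (at x)) \<and>
     \<Phi> a = mat 1"

text \<open>The coefficient \<open>P\<^sub>1\<^sup>-\<^sup>1 (i t H(x)\<^sup>-\<^sup>1 - P\<^sub>0)\<close>.\<close>

definition ode_coeff ::
    "real ^ 'n ^ 'n \<Rightarrow> real ^ 'n ^ 'n \<Rightarrow> (real \<Rightarrow> real ^ 'n ^ 'n) \<Rightarrow> real \<Rightarrow> real \<Rightarrow> complex ^ 'n ^ 'n" where
  "ode_coeff P\<^sub>1 P\<^sub>0 H t x =
     map_matrix complex_of_real (matrix_inv P\<^sub>1) **
       (map_matrix (\<lambda>r. \<i> * complex_of_real t * complex_of_real r) (matrix_inv (H x))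
        - map_matrix complex_of_real P\<^sub>0)"

definition sup_norm :: "real \<Rightarrow> real \<Rightarrow> (real \<Rightarrow> complex ^ 'n ^ 'n) \<Rightarrow> ereal" where
  "sup_norm a b \<Phi> = (SUP x\<in>{a..b}. ereal (onorm ((*v) (\<Phi> x))))"

end

theory Submission
  imports Defs
begin

text \<open>
  The bound is an energy estimate for \<open>u\<^sup>* H\<^sup>-\<^sup>1 u\<close>. Since \<open>P\<^sub>1\<^sup>-\<^sup>1\<close> and \<open>H\<^sup>-\<^sup>1\<close> are real symmetric, the
  term \<open>i t P\<^sub>1\<^sup>-\<^sup>1 H\<^sup>-\<^sup>1 u\<close> of the equation contributes \<open>2 Re (i t w\<^sup>* P\<^sub>1\<^sup>-\<^sup>1 w) = 0\<close> with
  \<open>w = H\<^sup>-\<^sup>1 u\<close> to the derivative of the energy while \<open>H\<close> is held fixed, so \<open>t\<close> drops out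
  (\<open>hyperbolic_energy_bound\<close>). What remains is a multiple of the energy coming from \<open>P\<^sub>0\<close>,
  and the variation of \<open>H\<close>.

  A function \<open>H\<close> of bounded variation has no derivative to put into a Gronwall argument, and it may
  jump. Instead, outside a null set there is a bounded function \<open>v\<close> with
  \<open>\<parallel>H y - H x\<parallel> \<le> v y - v x\<close> for \<open>x \<le> y\<close> (\<open>matrix_bounded_variation_potential\<close>), and for a suitable
  constant \<open>K\<close> the quadratic forms \<open>q\<^sub>x(w) = exp (- K v x) w\<^sup>* H(x)\<^sup>-\<^sup>1 w\<close> are nonincreasing in \<open>x\<close>
  (\<open>inverse_form_comparison\<close>). For \<open>x \<le> s \<le> y\<close> this gives
    \<open>q\<^sub>y(u y) - q\<^sub>x(u x) \<le> q\<^sub>s(u y) - q\<^sub>s(u x)\<close>,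
  where the form on the right is frozen at \<open>s\<close>. The right-hand side is controlled by the derivative of
  \<open>u\<close> at \<open>s\<close> for almost every \<open>s\<close>, and by the absolute continuity of \<open>u\<close> on the exceptional null
  set. Summing over a fine tagged division bounds \<open>q\<^sub>x(u x)\<close> by \<open>exp (k (x - a))\<close> times a multiple
  of \<open>\<parallel>u a\<parallel>\<^sup>2\<close> (\<open>lyapunov_bound\<close>), with \<open>k\<close> and all other constants independent of \<open>t\<close>.

  The passage from the distributional definition of bounded variation to the pointwise \<open>v\<close> tests
  \<open>H\<close> against smoothed step functions whose derivatives approximate differences of point evaluations
  at Lebesgue points (\<open>bounded_variation_imp_chain_sums_bounded\<close>).
\<close>

section \<open>Absolutely continuous functions\<close>

lemma abs_continuous_onE:
  fixes f :: "real \<Rightarrow> 'a::real_normed_vector"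
  assumes "abs_continuous_on a b f" "0 < e"
  obtains d where "d > 0"
    "\<And>D. \<lbrakk>D division_of \<Union>D; \<Union>D \<subseteq> {a..b}; (\<Sum>K\<in>D. Sup K - Inf K) < d\<rbrakk>
        \<Longrightarrow> (\<Sum>K\<in>D. norm (f (Sup K) - f (Inf K))) < e"
  using assms unfolding abs_continuous_on_def by meson

lemma abs_continuous_on_imp_continuous_on:
  fixes f :: "real \<Rightarrow> 'a::real_normed_vector"
  assumes "abs_continuous_on a b f"
  shows "continuous_on {a..b} f"
proof (clarsimp simp: continuous_on_iff)
  fix x e :: real
  assume x: "a \<le> x" "x \<le> b" and "0 < e"
  with assms obtain d where d: "d > 0"
    "\<And>D. \<lbrakk>D division_of \<Union>D; \<Union>D \<subseteq> {a..b}; (\<Sum>K\<in>D. Sup K - Inf K) < d\<rbrakk>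
        \<Longrightarrow> (\<Sum>K\<in>D. norm (f (Sup K) - f (Inf K))) < e"
    using abs_continuous_onE by blast
  have *: "norm (f v - f u) < e" if "u \<le> v" "u \<in> {a..b}" "v \<in> {a..b}" "v - u < d" for u v
  proof -
    have "{cbox u v} division_of \<Union>{cbox u v}"
      using division_of_self[of u v] that(1) by (simp del: box_real add: box_ne_empty)
    then show ?thesis
      using d(2)[of "{cbox u v}"] that by auto
  qed
  have "dist (f y) (f x) < e" if "a \<le> y" "y \<le> b" "dist y x < d" for y
    using *[of x y] *[of y x] that x by (cases "x \<le> y") (auto simp: dist_norm norm_minus_commute)
  with d(1) show "\<exists>d>0. \<forall>x'\<in>{a..b}. dist x' x < d \<longrightarrow> dist (f x') (f x) < e"
    by auto
qed

lemma abs_continuous_on_bounded_linear: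
  fixes f :: "real \<Rightarrow> 'a::real_normed_vector" and g :: "'a \<Rightarrow> 'b::real_normed_vector"
  assumes f: "abs_continuous_on a b f" and g: "bounded_linear g"
  shows "abs_continuous_on a b (\<lambda>x. g (f x))"
  unfolding abs_continuous_on_def
proof (intro allI impI)
  fix e :: real assume "e > 0"
  obtain B where B: "B > 0" "\<And>x. norm (g x) \<le> norm x * B"
    using bounded_linear.pos_bounded[OF g] by blast
  have "e / B > 0" using B(1) \<open>e > 0\<close> by simp
  then obtain d where d: "d > 0"
    "\<And>D. \<lbrakk>D division_of \<Union>D; \<Union>D \<subseteq> {a..b}; (\<Sum>K\<in>D. Sup K - Inf K) < d\<rbrakk>
        \<Longrightarrow> (\<Sum>K\<in>D. norm (f (Sup K) - f (Inf K))) < e / B"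
    using abs_continuous_onE[OF f] by blast
  have "(\<Sum>K\<in>D. norm (g (f (Sup K)) - g (f (Inf K)))) < e"
    if D: "D division_of \<Union>D" "\<Union>D \<subseteq> {a..b}" "(\<Sum>K\<in>D. Sup K - Inf K) < d" for D
  proof -
    have "(\<Sum>K\<in>D. norm (g (f (Sup K)) - g (f (Inf K)))) \<le> (\<Sum>K\<in>D. norm (f (Sup K) - f (Inf K)) * B)"
      by (intro sum_mono) (metis B(2) g linear_simps(2))
    also have "\<dots> < e"
      using d(2)[OF D] B(1) by (simp add: sum_distrib_right[symmetric] pos_less_divide_eq)
    finally show ?thesis .
  qed
  with d(1) show "\<exists>d>0. \<forall>D. D division_of \<Union>D \<longrightarrow> \<Union>D \<subseteq> {a..b} \<longrightarrow> (\<Sum>K\<in>D. Sup K - Inf K) < d \<longrightarrow>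
        (\<Sum>K\<in>D. norm (g (f (Sup K)) - g (f (Inf K)))) < e"
    by blast
qed

text \<open>
  A monotonicity criterion that asks for a derivative-like bound only off a null set and for no
  regularity of \<open>W\<close> itself. The null set is covered by an open set of small measure; in a tagged division
  fine enough for both bounds, the intervals tagged in the null set have small total length, so their
  contribution is small by absolute continuity of \<open>U\<close>. Jumps of \<open>W\<close> are harmless because only
  upper bounds for its increments are required.
\<close>

lemma antimono_of_local_bounds:
  fixes W :: "real \<Rightarrow> real" and U :: "real \<Rightarrow> 'a::real_normed_vector"
  assumes "a \<le> b" and N: "negligible N"
    and loc: "\<And>x e. \<lbrakk>x \<in> {a..b} - N; 0 < e\<rbrakk> \<Longrightarrow>
       \<exists>d>0. \<forall>u v. u \<in> {a..b} \<longrightarrow> v \<in> {a..b} \<longrightarrow> u \<le> x \<longrightarrow> x \<le> v \<longrightarrow> \<bar>u - x\<bar> < d \<longrightarrow> \<bar>v - x\<bar> < d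
            \<longrightarrow> W v - W u \<le> e * (v - u)"
    and U: "abs_continuous_on a b U"
    and glob: "\<And>u v. \<lbrakk>u \<in> {a..b}; v \<in> {a..b}; u \<le> v\<rbrakk> \<Longrightarrow> W v - W u \<le> L * norm (U v - U u)"
  shows "W b \<le> W a"
proof (rule field_le_epsilon)
  fix e0 :: real assume "0 < e0"
  define e where "e = e0 / (\<bar>L\<bar> + (b - a) + 1)"
  have pos: "\<bar>L\<bar> + (b - a) + 1 > 0" using \<open>a \<le> b\<close> by linarith
  have "e > 0" using \<open>e0 > 0\<close> pos by (simp add: e_def)
  obtain d where d: "d > 0"
    "\<And>D. \<lbrakk>D division_of \<Union>D; \<Union>D \<subseteq> {a..b}; (\<Sum>K\<in>D. Sup K - Inf K) < d\<rbrakk>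
        \<Longrightarrow> (\<Sum>K\<in>D. norm (U (Sup K) - U (Inf K))) < e"
    using abs_continuous_onE[OF U \<open>e > 0\<close>] by blast
  obtain T where T: "open T" "N \<subseteq> T" "T \<in> lmeasurable" "measure lebesgue T < d"
  proof -
    have "N \<in> sets lebesgue" using N by (simp add: negligible_imp_sets)
    then obtain T where T: "open T" "N \<subseteq> T" "T - N \<in> lmeasurable" "emeasure lebesgue (T - N) < ennreal d"
      using sets_lebesgue_outer_open d(1) by metis
    have TN: "T = (T - N) \<union> N" using T by auto
    have Tm: "T \<in> lmeasurable"
      using T(3) N TN by (metis fmeasurable.Un negligible_imp_measurable)
    have "measure lebesgue T = measure lebesgue (T - N)"
      using N T(1) by (simp add: measure_Diff_null_set negligible_iff_null_sets)
    also have "\<dots> < d"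
      using T(3,4) d(1) by (simp add: emeasure_eq_measure2 ennreal_less_iff)
    finally show ?thesis using that T Tm by blast
  qed
  obtain r where r: "\<And>x. x \<in> {a..b} - N \<Longrightarrow> 0 < r x"
    "\<And>x u v. \<lbrakk>x \<in> {a..b} - N; u \<in> {a..b}; v \<in> {a..b}; u \<le> x; x \<le> v; \<bar>u - x\<bar> < r x; \<bar>v - x\<bar> < r x\<rbrakk>
            \<Longrightarrow> W v - W u \<le> e * (v - u)"
    using loc[OF _ \<open>e > 0\<close>] by metis
  define g where "g = (\<lambda>x. if x \<in> N then T else if x \<in> {a..b} then ball x (r x) else ball x 1)"
  have "gauge g"
    unfolding gauge_def g_def using T r(1) by auto
  then obtain p where p: "p tagged_division_of {a..b}" "g fine p"
    using fine_division_exists_real by blast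
  have fin: "finite p" using p(1) by blast
  have pK: "x \<in> {a..b} \<and> (\<exists>u v. K = {u..v} \<and> u \<le> x \<and> x \<le> v \<and> a \<le> u \<and> v \<le> b \<and> Sup K = v \<and> Inf K = u)
     \<and> K \<subseteq> g x"
    if xKp: "(x, K) \<in> p" for x K
  proof -
    obtain u v where K: "K = cbox u v" using tagged_division_ofD(4)[OF p(1) xKp] by blast
    have xK: "x \<in> K" "K \<subseteq> {a..b}" using tagged_division_ofD(2,3)[OF p(1) xKp] by blast+
    then have "u \<le> v" using K by auto
    with xK K p(2) xKp show ?thesis by (auto simp: fine_def)
  qed
  define B where "B = {(x, K) \<in> p. x \<in> N}"
  have Bp: "B \<subseteq> p" by (auto simp: B_def)
  have Bdiv: "B tagged_division_of \<Union>(snd ` B)"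
  proof -
    have "B tagged_partial_division_of {a..b}"
      using p(1) Bp tagged_division_of_def tagged_partial_division_subset by metis
    then show ?thesis
      using tagged_partial_division_of_Union_self by blast
  qed
  have div: "(snd ` B) division_of \<Union>(snd ` B)"
    using Bdiv division_of_tagged_division by blast
  have sub: "\<Union>(snd ` B) \<subseteq> {a..b}" "\<Union>(snd ` B) \<subseteq> T"
    using pK Bp by (force simp: B_def g_def)+
  have len: "(\<Sum>K\<in>snd ` B. Sup K - Inf K) < d"
  proof -
    have "(\<Sum>K\<in>snd ` B. Sup K - Inf K) = (\<Sum>K\<in>snd ` B. measure lebesgue K)"
    proof (intro sum.cong refl)
      fix K assume "K \<in> snd ` B"
      then obtain x where "(x, K) \<in> p" using Bp by auto
      then obtain u v where "K = {u..v}" "u \<le> v" "Sup K = v" "Inf K = u" using pK[of x K] by auto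
      then show "Sup K - Inf K = measure lebesgue K" by simp
    qed
    also have "\<dots> = measure lebesgue (\<Union>(snd ` B))"
      by (rule content_division[OF div])
    also have "\<dots> \<le> measure lebesgue T"
      by (rule measure_mono_fmeasurable[OF sub(2) fmeasurableD[OF lmeasurable_division[OF div]] T(3)])
    finally show ?thesis using T by linarith
  qed
  have bad: "(\<Sum>(x,K)\<in>B. norm (U (Sup K) - U (Inf K))) < e"
  proof -
    \<comment> \<open>Two tags may share a degenerate interval, so passing from tagged to untagged intervals needs a
      summand that vanishes on intervals with empty interior, including the empty one.\<close>
    define h where "h = (\<lambda>K. if K = {} then 0 else norm (U (Sup K) - U (Inf K)))"
    have "(\<Sum>(x,K)\<in>B. h K) = (\<Sum>K\<in>snd ` B. h K)"
      by (rule sum.over_tagged_division_lemma[OF Bdiv]) (auto simp: h_def box_eq_empty)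
    note * = this
    have h: "h K = norm (U (Sup K) - U (Inf K))" if "(x, K) \<in> B" for x K
      using pK[OF subsetD[OF Bp that]] by (auto simp: h_def)
    have "(\<Sum>(x,K)\<in>B. h K) = (\<Sum>(x,K)\<in>B. norm (U (Sup K) - U (Inf K)))"
      "(\<Sum>K\<in>snd ` B. h K) = (\<Sum>K\<in>snd ` B. norm (U (Sup K) - U (Inf K)))"
      by (rule sum.cong; auto simp: h)+
    with * have "(\<Sum>(x,K)\<in>B. norm (U (Sup K) - U (Inf K))) = (\<Sum>K\<in>snd ` B. norm (U (Sup K) - U (Inf K)))"
      by simp
    with d(2)[OF div sub(1) len] show ?thesis by simp
  qed
  have "W b - W a = (\<Sum>(x,K)\<in>p. W (Sup K) - W (Inf K))"
    using additive_tagged_division_1[OF \<open>a \<le> b\<close> p(1), of W] by simp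
  also have "\<dots> \<le> (\<Sum>(x,K)\<in>p. (if (x,K) \<in> B then \<bar>L\<bar> * norm (U (Sup K) - U (Inf K)) else 0) + e * (Sup K - Inf K))"
  proof (rule sum_mono, clarify)
    fix x K assume xK: "(x, K) \<in> p"
    then obtain u v where uv: "K = {u..v}" "u \<le> x" "x \<le> v" "a \<le> u" "v \<le> b" "Sup K = v" "Inf K = u"
      and x: "x \<in> {a..b}" and Kg: "K \<subseteq> g x"
      using pK by blast
    show "W (Sup K) - W (Inf K) \<le> (if (x,K) \<in> B then \<bar>L\<bar> * norm (U (Sup K) - U (Inf K)) else 0) + e * (Sup K - Inf K)"
    proof (cases "x \<in> N")
      case True
      then have "(x,K) \<in> B" using xK by (simp add: B_def)
      have "W v - W u \<le> L * norm (U v - U u)" using glob uv x by auto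
      also have "\<dots> \<le> \<bar>L\<bar> * norm (U v - U u)" by (intro mult_right_mono) auto
      finally show ?thesis using \<open>(x,K) \<in> B\<close> \<open>e > 0\<close> uv by (simp add: add_increasing2)
    next
      case False
      then have "K \<subseteq> ball x (r x)" using Kg x by (simp add: g_def)
      moreover have "u \<in> K" "v \<in> K" using uv by auto
      ultimately have "u \<in> ball x (r x)" "v \<in> ball x (r x)" by blast+
      then have "W v - W u \<le> e * (v - u)"
        using r(2)[of x u v] x uv False by (auto simp: dist_real_def abs_minus_commute)
      then show ?thesis using False uv by (simp add: B_def)
    qed
  qed
  also have "\<dots> = (\<Sum>(x,K)\<in>B. \<bar>L\<bar> * norm (U (Sup K) - U (Inf K))) + e * (b - a)"
  proof -
    have "(\<Sum>(x,K)\<in>p. e * (Sup K - Inf K)) = e * (b - a)"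
      using additive_tagged_division_1[OF \<open>a \<le> b\<close> p(1), of "\<lambda>x. x"]
      by (simp add: sum_distrib_left[symmetric] case_prod_unfold)
    moreover have "(\<Sum>(x,K)\<in>p. (if (x,K) \<in> B then \<bar>L\<bar> * norm (U (Sup K) - U (Inf K)) else 0))
       = (\<Sum>(x,K)\<in>B. \<bar>L\<bar> * norm (U (Sup K) - U (Inf K)))"
      using Bp fin by (simp add: case_prod_unfold sum.inter_restrict[symmetric] Int_absorb1)
    ultimately show ?thesis by (simp add: case_prod_unfold sum.distrib)
  qed
  also have "\<dots> \<le> \<bar>L\<bar> * e + e * (b - a)"
    using bad by (auto simp: case_prod_unfold sum_distrib_left[symmetric] intro!: mult_left_mono)
  also have "\<dots> \<le> e * (\<bar>L\<bar> + (b - a) + 1)"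
    using \<open>e > 0\<close> by (simp add: algebra_simps)
  also have "\<dots> = e0" using pos by (simp add: e_def)
  finally show "W b \<le> W a + e0" by simp
qed

lemma AE_lebesgue_on_negligible:
  assumes "AE x in lebesgue_on S. P x" "S \<in> sets lebesgue"
  obtains N where "negligible N" "\<And>x. x \<in> S - N \<Longrightarrow> P x"
proof -
  from assms have "AE x in lebesgue. x \<in> S \<longrightarrow> P x"
    by (simp add: AE_restrict_space_iff)
  then obtain N where N: "N \<in> null_sets lebesgue" "{x \<in> space lebesgue. \<not> (x \<in> S \<longrightarrow> P x)} \<subseteq> N"
    unfolding eventually_ae_filter by blast
  then show ?thesis
    using that[of N] by (auto simp: negligible_iff_null_sets)
qed

section \<open>Decreasing families of Lyapunov functions\<close>

lemma straddle_derivative_nonpos: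
  fixes g :: "real \<Rightarrow> real"
  assumes g: "(g has_real_derivative D) (at x)" and "D \<le> 0" "0 < e"
  shows "\<exists>d>0. \<forall>u v. u \<le> x \<longrightarrow> x \<le> v \<longrightarrow> \<bar>u - x\<bar> < d \<longrightarrow> \<bar>v - x\<bar> < d \<longrightarrow> g v - g u \<le> e * (v - u)"
proof -
  have "(g has_derivative (\<lambda>h. D * h)) (at x)"
    using g by (simp add: has_field_derivative_def)
  then have "\<exists>d>0. \<forall>y. norm (y - x) < d \<longrightarrow> norm (g y - g x - D * (y - x)) \<le> e * norm (y - x)"
    using \<open>0 < e\<close> by (simp add: has_derivative_at_alt)
  then obtain d where "d > 0"
    and "\<forall>y. norm (y - x) < d \<longrightarrow> norm (g y - g x - D * (y - x)) \<le> e * norm (y - x)"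
    by blast
  then have d: "d > 0" "\<And>y. \<bar>y - x\<bar> < d \<Longrightarrow> \<bar>g y - g x - D * (y - x)\<bar> \<le> e * \<bar>y - x\<bar>"
    by auto
  have "g v - g u \<le> e * (v - u)" if "u \<le> x" "x \<le> v" "\<bar>u - x\<bar> < d" "\<bar>v - x\<bar> < d" for u v
  proof -
    have "\<bar>g v - g x - D * (v - x)\<bar> \<le> e * (v - x)" using d(2)[of v] that by simp
    moreover have "\<bar>g u - g x - D * (u - x)\<bar> \<le> e * (x - u)" using d(2)[of u] that
      by (simp add: abs_minus_commute)
    moreover have "(v - u) * D \<le> 0" using that \<open>D \<le> 0\<close> by (simp add: mult_nonneg_nonpos)
    ultimately show ?thesis by (simp add: algebra_simps)
  qed
  with d(1) show ?thesis by blast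
qed

text \<open>
  The forms \<open>q x\<close> decrease in \<open>x\<close>, so for \<open>u \<le> s \<le> v\<close> the increment of \<open>x \<mapsto> q x (z x)\<close> over \<open>[u, v]\<close> is
  at most that of \<open>x \<mapsto> q s (z x)\<close>. Only the latter is differentiated, at \<open>s\<close>; hence \<open>q\<close> may depend
  discontinuously on \<open>x\<close>. The factor \<open>exp (- k (x - a))\<close> absorbs the growth rate \<open>k\<close>.
\<close>

lemma lyapunov_bound:
  fixes z :: "real \<Rightarrow> 'a::real_normed_vector" and q :: "real \<Rightarrow> 'a \<Rightarrow> real"
  assumes "0 < c" "c \<le> C" "0 \<le> k"
    and N: "negligible N"
    and z: "abs_continuous_on a b z"
    and lower: "\<And>x w. x \<in> {a<..<b} - N \<Longrightarrow> c * (norm w)\<^sup>2 \<le> q x w"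
    and upper: "\<And>x w. x \<in> {a<..<b} - N \<Longrightarrow> q x w \<le> C * (norm w)\<^sup>2"
    and lip: "\<And>x w w'. x \<in> {a<..<b} - N \<Longrightarrow> q x w - q x w' \<le> C * (norm w + norm w') * norm (w - w')"
    and anti: "\<And>x y w. \<lbrakk>x \<in> {a<..<b} - N; y \<in> {a<..<b} - N; x \<le> y\<rbrakk> \<Longrightarrow> q y w \<le> q x w"
    and deriv: "\<And>x. x \<in> {a<..<b} - N \<Longrightarrow>
        \<exists>D. ((\<lambda>s. q x (z s)) has_real_derivative D) (at x) \<and> D \<le> k * q x (z x)"
    and x: "x \<in> {a..b}"
  shows "c * (norm (z x))\<^sup>2 \<le> exp (k * (b - a)) * C * (norm (z a))\<^sup>2"
proof -
  have "0 \<le> C" using \<open>0 < c\<close> \<open>c \<le> C\<close> by simp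
  define G where "G = {a<..<b} - N"
  \<comment> \<open>Tagged divisions have arbitrary endpoints, so the forms are extended to all points as the infimum
    over the admissible points to the left. The upper bound \<open>C * (norm w)\<^sup>2\<close> joins the set to keep it
    nonempty at \<open>a\<close>; it does not change the infimum at admissible points.\<close>
  define S where "S = (\<lambda>s w. insert (C * (norm w)\<^sup>2) ((\<lambda>g. q g w) ` {g \<in> G. g \<le> s}))"
  define Q where "Q = (\<lambda>s w. Inf (S s w))"
  have Sne: "S s w \<noteq> {}" for s w by (auto simp: S_def)
  have Slow: "c * (norm w)\<^sup>2 \<le> y" if "y \<in> S s w" for s w y
    using that lower[folded G_def] mult_right_mono[OF \<open>c \<le> C\<close>, of "(norm w)\<^sup>2"]
    by (auto simp: S_def intro: order_trans)
  have Sbdd: "bdd_below (S s w)" for s w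
    using Slow by (meson bdd_below.I)
  have Qlow: "c * (norm w)\<^sup>2 \<le> Q s w" for s w
    unfolding Q_def using Slow by (intro cInf_greatest[OF Sne])
  have Qnn: "0 \<le> Q s w" for s w
    using Qlow[of w s] \<open>0 < c\<close> \<open>0 \<le> C\<close> by (smt (verit, best) mult_nonneg_nonneg zero_le_power2)
  have Qup: "Q s w \<le> C * (norm w)\<^sup>2" for s w
    unfolding Q_def by (rule cInf_lower[OF _ Sbdd]) (simp add: S_def)
  have Qanti: "Q t w \<le> Q s w" if "s \<le> t" for s t w
    unfolding Q_def by (rule cInf_superset_mono[OF Sne Sbdd]) (use that in \<open>auto simp: S_def\<close>)
  have Qle: "Q s w \<le> q g w" if "g \<in> G" "g \<le> s" for g s w
    unfolding Q_def by (rule cInf_lower[OF _ Sbdd]) (use that in \<open>auto simp: S_def\<close>)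
  have Qge: "q g w \<le> Q s w" if "g \<in> G" "s \<le> g" for g s w
    unfolding Q_def using that upper[folded G_def] anti[folded G_def]
    by (intro cInf_greatest[OF Sne]) (auto simp: S_def)
  have Qlip: "Q s w \<le> Q s w' + C * (norm w + norm w') * norm (w - w')" for s w w'
  proof -
    have "Q s w - C * (norm w + norm w') * norm (w - w') \<le> y" if "y \<in> S s w'" for y
    proof -
      from that consider "y = C * (norm w')\<^sup>2" | g where "g \<in> G" "g \<le> s" "y = q g w'"
        by (auto simp: S_def)
      then show ?thesis
      proof cases
        case 1
        have "(norm w)\<^sup>2 - (norm w')\<^sup>2 = (norm w + norm w') * (norm w - norm w')"
          by (simp add: power2_eq_square algebra_simps)
        also have "\<dots> \<le> (norm w + norm w') * norm (w - w')"
          by (intro mult_left_mono norm_triangle_ineq2) auto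
        finally have "C * ((norm w)\<^sup>2 - (norm w')\<^sup>2) \<le> C * ((norm w + norm w') * norm (w - w'))"
          using \<open>0 \<le> C\<close> by (rule mult_left_mono)
        then show ?thesis using Qup[of s w] 1 by (simp add: algebra_simps)
      next
        case 2
        then show ?thesis using Qle[of g s w] lip[folded G_def, of g w w'] by simp
      qed
    qed
    then have "Q s w - C * (norm w + norm w') * norm (w - w') \<le> Inf (S s w')"
      by (intro cInf_greatest[OF Sne])
    moreover have "Q s w' = Inf (S s w')" by (simp add: Q_def)
    ultimately show ?thesis by simp
  qed
  have "bounded (z ` {a..b})"
    using abs_continuous_on_imp_continuous_on[OF z] by (intro compact_imp_bounded compact_continuous_image) auto
  then obtain M where "\<And>y. y \<in> z ` {a..b} \<Longrightarrow> norm y \<le> M"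
    unfolding bounded_iff by blast
  then have M: "\<And>s. s \<in> {a..b} \<Longrightarrow> norm (z s) \<le> M" by blast
  define W where "W = (\<lambda>s. exp (- k * (s - a)) * Q s (z s))"
  have Wle: "W v - W u \<le> exp (- k * (v - a)) * Q s (z v) - exp (- k * (u - a)) * Q s (z u)" 
    if "u \<le> s" "s \<le> v" for u v s
    unfolding W_def using Qanti[of s v "z v"] Qanti[of u s "z u"] that
    by (intro diff_mono mult_left_mono) auto
  have "W x \<le> W a"
  proof (rule antimono_of_local_bounds[where W = W and a = a and b = x and U = z and N = "insert a (insert b N)" and L = "C * (M + M)"])
    show "a \<le> x" using x by simp
    show "negligible (insert a (insert b N))" using N by simp
    show "abs_continuous_on a x z"
    proof -
      have "{a..x} \<subseteq> {a..b}" using x by auto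
      then show ?thesis using z unfolding abs_continuous_on_def by (meson subset_trans)
    qed
    show "W v - W u \<le> C * (M + M) * norm (z v - z u)" if "u \<in> {a..x}" "v \<in> {a..x}" "u \<le> v" for u v
    proof -
      have E1: "exp (- k * (v - a)) \<le> 1" "exp (- k * (v - a)) \<le> exp (- k * (u - a))"
        using \<open>0 \<le> k\<close> that by (auto intro!: mult_left_mono)
      have M0: "0 \<le> M" using M[of a] x norm_ge_zero[of "z a"] by (smt (verit) atLeastAtMost_iff)
      have "Q u (z v) - Q u (z u) \<le> C * (norm (z v) + norm (z u)) * norm (z v - z u)"
        using Qlip[of u "z v" "z u"] by simp
      also have "\<dots> \<le> C * (M + M) * norm (z v - z u)"
        using that x M \<open>0 \<le> C\<close> by (intro mult_right_mono mult_left_mono add_mono) auto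
      finally have D: "Q u (z v) - Q u (z u) \<le> C * (M + M) * norm (z v - z u)" .
      have "W v - W u \<le> exp (- k * (v - a)) * Q u (z v) - exp (- k * (u - a)) * Q u (z u)"
        using Wle[of u u v] that by simp
      also have "\<dots> \<le> exp (- k * (v - a)) * Q u (z v) - exp (- k * (v - a)) * Q u (z u)"
        using E1 Qnn[of u "z u"] by (intro diff_left_mono mult_right_mono) auto
      also have "\<dots> = exp (- k * (v - a)) * (Q u (z v) - Q u (z u))" by (simp add: algebra_simps)
      also have "\<dots> \<le> exp (- k * (v - a)) * (C * (M + M) * norm (z v - z u))"
        using D by (intro mult_left_mono) auto
      also have "\<dots> \<le> C * (M + M) * norm (z v - z u)"
        using E1 M0 \<open>0 \<le> C\<close> by (intro mult_left_le_one_le) auto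
      finally show ?thesis .
    qed
    fix s e :: real
    assume s: "s \<in> {a..x} - insert a (insert b N)" and "0 < e"
    then have sG: "s \<in> G" using x by (auto simp: G_def)
    then obtain D where D: "((\<lambda>r. q s (z r)) has_real_derivative D) (at s)" "D \<le> k * q s (z s)"
      using deriv[folded G_def] by blast
    have "((\<lambda>r. exp (- k * (r - a)) * q s (z r)) has_real_derivative 
       (exp (- k * (s - a)) * (D - k * q s (z s)))) (at s)"
      by (rule derivative_eq_intros D refl | simp)+ (simp add: algebra_simps)
    moreover have "exp (- k * (s - a)) * (D - k * q s (z s)) \<le> 0"
      using D(2) by (simp add: mult_nonneg_nonpos)
    ultimately obtain d where "d > 0" and d: "\<And>u v. \<lbrakk>u \<le> s; s \<le> v; \<bar>u - s\<bar> < d; \<bar>v - s\<bar> < d\<rbrakk> \<Longrightarrow>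
        exp (- k * (v - a)) * q s (z v) - exp (- k * (u - a)) * q s (z u) \<le> e * (v - u)"
      using straddle_derivative_nonpos \<open>0 < e\<close> by meson
    moreover have "Q s w = q s w" for w using Qle[OF sG] Qge[OF sG] by (simp add: antisym)
    ultimately show "\<exists>d>0. \<forall>u v. u \<in> {a..x} \<longrightarrow> v \<in> {a..x} \<longrightarrow> u \<le> s \<longrightarrow> s \<le> v \<longrightarrow> \<bar>u - s\<bar> < d \<longrightarrow>
        \<bar>v - s\<bar> < d \<longrightarrow> W v - W u \<le> e * (v - u)"
      using Wle by (intro exI[of _ d]) (smt (verit, best))
  qed
  then have "exp (- k * (x - a)) * Q x (z x) \<le> C * (norm (z a))\<^sup>2"
    using Qup[of a "z a"] by (simp add: W_def)
  moreover have "exp (- k * (b - a)) \<le> exp (- k * (x - a))"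
    using x \<open>0 \<le> k\<close> by (auto intro!: mult_left_mono)
  then have "exp (- k * (b - a)) * Q x (z x) \<le> exp (- k * (x - a)) * Q x (z x)"
    using Qnn by (intro mult_right_mono)
  ultimately have "exp (- (k * (b - a))) * Q x (z x) \<le> C * (norm (z a))\<^sup>2" by simp
  then have "exp (k * (b - a)) * (exp (- (k * (b - a))) * Q x (z x)) \<le> exp (k * (b - a)) * (C * (norm (z a))\<^sup>2)"
    by (intro mult_left_mono) auto
  then have "Q x (z x) \<le> exp (k * (b - a)) * (C * (norm (z a))\<^sup>2)"
    by (simp add: mult.assoc[symmetric] exp_add[symmetric])
  then show ?thesis using Qlow[of "z x" x] by simp
qed

section \<open>Pointwise variation of functions of bounded variation\<close>

text \<open>
  A continuous kernel of mass \<open>(h - d) / h\<close> supported in \<open>[0, h]\<close>: it rises to \<open>1 / h\<close> on \<open>[0, d]\<close>, stays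
  there, and falls on \<open>[h - d, h]\<close>. Being continuous it has a primitive of class \<open>C\<^sup>1\<close>, and for
  \<open>d \<rightarrow> 0\<close> it becomes the box kernel of an average over an interval of length \<open>h\<close>, to which the Lebesgue
  differentiation theorem applies.
\<close>

definition trapezoid :: "real \<Rightarrow> real \<Rightarrow> real \<Rightarrow> real" where
  "trapezoid h d s = (max 0 s - max 0 (s - d) - max 0 (s - h + d) + max 0 (s - h)) / (h * d)"

text \<open>
  The primitive of \<open>trapezoid h d\<close> that vanishes at \<open>0\<close>.
\<close>

definition smooth_step :: "real \<Rightarrow> real \<Rightarrow> real \<Rightarrow> real" where
  "smooth_step h d s = ((max 0 s)\<^sup>2 - (max 0 (s - d))\<^sup>2 - (max 0 (s - h + d))\<^sup>2 + (max 0 (s - h))\<^sup>2) / (2 * h * d)"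

lemma max0_square_deriv: "((\<lambda>s::real. (max 0 s)\<^sup>2) has_real_derivative 2 * max 0 x) (at x)"
proof -
  consider "x < 0" | "x = 0" | "x > 0" by linarith
  then show ?thesis
  proof cases
    case 1
    have "((\<lambda>s::real. 0) has_real_derivative 0) (at x)" by simp
    from has_field_derivative_transform_within_open[OF this, of "{..<0}"] 1 show ?thesis
      by (simp add: max_def)
  next
    case 3
    have "((\<lambda>s::real. s\<^sup>2) has_real_derivative 2 * x) (at x)" by (auto intro!: derivative_eq_intros)
    from has_field_derivative_transform_within_open[OF this, of "{0<..}"] 3 show ?thesis
      by (simp add: max_def)
  next
    case 2
    have "((\<lambda>h::real. max 0 h) \<longlongrightarrow> max 0 0) (at 0)" by (intro tendsto_intros)
    moreover have "(max 0 h)\<^sup>2 / h = max 0 h" for h :: real by (auto simp: max_def power2_eq_square)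
    ultimately show ?thesis using 2 by (simp add: DERIV_def)
  qed
qed

lemma smooth_step_deriv:
  assumes "h > 0" "d > 0"
  shows "(smooth_step h d has_real_derivative trapezoid h d s) (at s)"
proof -
  have *: "((\<lambda>s::real. (max 0 (s + c))\<^sup>2) has_real_derivative 2 * max 0 (x + c)) (at x)" for c x
    using DERIV_shift[of "\<lambda>s. (max 0 s)\<^sup>2" "2 * max 0 (x + c)" x c] max0_square_deriv by blast
  have "((\<lambda>s. ((max 0 (s + 0))\<^sup>2 - (max 0 (s + - d))\<^sup>2 - (max 0 (s + (d - h)))\<^sup>2 + (max 0 (s + - h))\<^sup>2) / (2 * h * d))
     has_real_derivative (2 * max 0 (s + 0) - 2 * max 0 (s + - d) - 2 * max 0 (s + (d - h)) + 2 * max 0 (s + - h)) / (2 * h * d)) (at s)"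
    by (rule DERIV_cdivide DERIV_add DERIV_diff *)+
  moreover have "(2 * max 0 (s + 0) - 2 * max 0 (s + - d) - 2 * max 0 (s + (d - h)) + 2 * max 0 (s + - h)) / (2 * h * d) = trapezoid h d s"
    using assms by (simp add: trapezoid_def field_simps)
  moreover have "(\<lambda>s. ((max 0 (s + 0))\<^sup>2 - (max 0 (s + - d))\<^sup>2 - (max 0 (s + (d - h)))\<^sup>2 + (max 0 (s + - h))\<^sup>2) / (2 * h * d)) = smooth_step h d"
    by (auto simp: smooth_step_def algebra_simps)
  ultimately show ?thesis by simp
qed

lemma trapezoid_bounds:
  assumes "0 < d" "2 * d \<le> h"
  shows "0 \<le> trapezoid h d s" "trapezoid h d s \<le> 1 / h"
proof -
  have "0 \<le> max 0 s - max 0 (s - d) - max 0 (s - h + d) + max 0 (s - h)"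
    "max 0 s - max 0 (s - d) - max 0 (s - h + d) + max 0 (s - h) \<le> d"
    using assms by (auto simp: max_def)
  then show "0 \<le> trapezoid h d s" "trapezoid h d s \<le> 1 / h"
    using assms unfolding trapezoid_def by (auto simp: divide_simps mult.commute)
qed

lemma trapezoid_tendsto:
  assumes "0 < h"
  shows "((\<lambda>d. trapezoid h d s) \<longlongrightarrow> indicator {0<..<h} s / h) (at_right 0)"
proof -
  consider "s \<le> 0" | "0 < s" "s < h" | "h \<le> s" by linarith
  then show ?thesis
  proof cases
    case 1
    have "eventually (\<lambda>d. trapezoid h d s = 0) (at_right 0)"
      using eventually_at_right_less[of 0] eventually_at_right_real[OF \<open>0 < h\<close>]
      by eventually_elim (use 1 in \<open>auto simp: trapezoid_def max_def\<close>)
    with 1 show ?thesis by (simp add: tendsto_eventually)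
  next
    case 2
    then have "0 < min s (h - s)" by simp
    from eventually_at_right_real[OF this]
    have "eventually (\<lambda>d. trapezoid h d s = 1 / h) (at_right 0)"
      by eventually_elim (use 2 in \<open>auto simp: trapezoid_def max_def field_simps\<close>)
    with 2 show ?thesis by (simp add: tendsto_eventually)
  next
    case 3
    have "eventually (\<lambda>d. trapezoid h d s = 0) (at_right 0)"
      using eventually_at_right_real[OF \<open>0 < h\<close>]
      by eventually_elim (use 3 in \<open>auto simp: trapezoid_def max_def\<close>)
    with 3 show ?thesis by (simp add: tendsto_eventually)
  qed
qed

lemma smooth_step_mono:
  assumes "0 < d" "2 * d \<le> h" "s \<le> t"
  shows "smooth_step h d s \<le> smooth_step h d t"
proof (rule DERIV_nonneg_imp_nondecreasing[OF \<open>s \<le> t\<close>])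
  show "\<exists>y. (smooth_step h d has_real_derivative y) (at x) \<and> 0 \<le> y" for x
    using smooth_step_deriv[of h d x] trapezoid_bounds(1)[of d h x] assms by auto
qed

lemma smooth_step_left: "\<lbrakk>0 < d; 2 * d \<le> h; s \<le> 0\<rbrakk> \<Longrightarrow> smooth_step h d s = 0"
  by (auto simp: smooth_step_def max_def)

lemma smooth_step_right: "\<lbrakk>0 < d; 2 * d \<le> h; h \<le> s\<rbrakk> \<Longrightarrow> smooth_step h d s = (h - d) / h"
  by (auto simp: smooth_step_def max_def power2_eq_square field_simps)

lemma smooth_step_range:
  assumes "0 < d" "2 * d \<le> h"
  shows "0 \<le> smooth_step h d s" "smooth_step h d s \<le> 1"
proof -
  show "0 \<le> smooth_step h d s"
    using smooth_step_mono[OF assms, of "min 0 s" s] smooth_step_left[OF assms, of "min 0 s"] by simp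
  have "smooth_step h d s \<le> (h - d) / h"
    using smooth_step_mono[OF assms, of s "max h s"] smooth_step_right[OF assms, of "max h s"] by simp
  also have "\<dots> \<le> 1" using assms by simp
  finally show "smooth_step h d s \<le> 1" .
qed

lemma bounded_variation_test_bound:
  assumes "bounded_variation a b \<alpha>"
  obtains V where "\<And>\<phi>. \<lbrakk>\<phi> \<in> C1_compact_support a b; \<And>x. \<bar>\<phi> x\<bar> \<le> 1\<rbrakk>
    \<Longrightarrow> integral\<^sup>L (lebesgue_on {a<..<b}) (\<lambda>x. \<alpha> x * deriv \<phi> x) \<le> V"
proof -
  let ?F = "{\<phi> \<in> C1_compact_support a b. \<forall>x. \<bar>\<phi> x\<bar> \<le> 1}"
  let ?I = "\<lambda>\<phi>. integral\<^sup>L (lebesgue_on {a<..<b}) (\<lambda>x. \<alpha> x * deriv \<phi> x)"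
  have lt: "(SUP \<phi>\<in>?F. ereal \<bar>?I \<phi>\<bar>) < \<infinity>"
    using assms unfolding bounded_variation_def by blast
  have "?I \<phi> \<le> real_of_ereal (SUP \<phi>\<in>?F. ereal \<bar>?I \<phi>\<bar>)" if "\<phi> \<in> ?F" for \<phi>
  proof -
    have "ereal \<bar>?I \<phi>\<bar> \<le> (SUP \<phi>\<in>?F. ereal \<bar>?I \<phi>\<bar>)"
      using that by (rule SUP_upper)
    with lt have "\<bar>?I \<phi>\<bar> \<le> real_of_ereal (SUP \<phi>\<in>?F. ereal \<bar>?I \<phi>\<bar>)"
      by (cases "SUP \<phi>\<in>?F. ereal \<bar>?I \<phi>\<bar>") auto
    then show ?thesis by linarith
  qed
  then show ?thesis using that by blast
qed

text \<open>
  With \<open>R = smooth_step h d\<close>, the function \<open>\<phi>(s) = (\<Sum>k<n. \<sigma> k * (R (s - c k) - R (s - c (Suc k))))\<close> is an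
  admissible test function: the differences of the increasing function \<open>R\<close> are nonnegative and telescope
  to at most \<open>1\<close>, so \<open>\<bar>\<phi>\<bar> \<le> 1\<close>, and they cancel to the right of \<open>c n + h\<close>, where \<open>R\<close> is constant.
  Its derivative evaluates \<open>\<alpha>\<close> to the weighted sum of differences of local averages.
\<close>

lemma smoothed_chain_sum_le:
  fixes c :: "nat \<Rightarrow> real"
  assumes \<alpha>: "integrable (lebesgue_on {a<..<b}) \<alpha>"
    and V: "\<And>\<phi>. \<lbrakk>\<phi> \<in> C1_compact_support a b; \<And>x. \<bar>\<phi> x\<bar> \<le> 1\<rbrakk>
    \<Longrightarrow> integral\<^sup>L (lebesgue_on {a<..<b}) (\<lambda>x. \<alpha> x * deriv \<phi> x) \<le> V"
    and c: "\<And>k. k < n \<Longrightarrow> c k \<le> c (Suc k)" and "a < c 0" "c n + h < b"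
    and d: "0 < d" "2 * d \<le> h"
    and \<sigma>: "\<And>k. \<bar>\<sigma> k\<bar> \<le> (1::real)"
  defines "I \<equiv> (\<lambda>x. integral\<^sup>L (lebesgue_on {a<..<b}) (\<lambda>s. \<alpha> s * trapezoid h d (s - x)))"
  shows "(\<Sum>k<n. \<sigma> k * (I (c k) - I (c (Suc k)))) \<le> V"
proof -
  have h: "0 < h" using d by linarith
  define R where "R = smooth_step h d"
  define \<phi> where "\<phi> = (\<lambda>s. \<Sum>k<n. \<sigma> k * (R (s - c k) - R (s - c (Suc k))))"
  define \<phi>' where "\<phi>' = (\<lambda>s. \<Sum>k<n. \<sigma> k * (trapezoid h d (s - c k) - trapezoid h d (s - c (Suc k))))"
  have cmono: "c i \<le> c j" if "i \<le> j" "j \<le> n" for i j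
    using that c by (induction rule: dec_induct) (auto intro: order_trans)
  have D: "(\<phi> has_real_derivative \<phi>' s) (at s)" for s
  proof -
    have "((\<lambda>s. R (s - x)) has_real_derivative trapezoid h d (s - x)) (at s)" for x
      using DERIV_shift[of R "trapezoid h d (s - x)" s "- x"] smooth_step_deriv[OF h d(1), of "s - x"]
      by (simp add: R_def)
    then show ?thesis unfolding \<phi>_def \<phi>'_def
      by (intro DERIV_sum DERIV_cmult DERIV_diff)
  qed
  then have deriv: "deriv \<phi> = \<phi>'" by (auto intro!: DERIV_imp_deriv)
  have tcont: "continuous_on UNIV (\<lambda>s. trapezoid h d (s - x))" for x
    using h d unfolding trapezoid_def by (intro continuous_intros) auto
  have "\<phi> \<in> C1_compact_support a b"
    unfolding C1_compact_support_def
  proof (intro CollectI conjI)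
    show "\<phi> C1_differentiable_on UNIV"
      unfolding C1_differentiable_on_def
    proof (intro exI conjI ballI)
      show "(\<phi> has_vector_derivative \<phi>' s) (at s)" for s
        using D by (simp add: has_real_derivative_iff_has_vector_derivative)
      show "continuous_on UNIV \<phi>'" unfolding \<phi>'_def
        by (intro continuous_intros tcont)
    qed
    have "{x. \<phi> x \<noteq> 0} \<subseteq> {c 0..c n + h}"
    proof
      fix s assume s: "s \<in> {x. \<phi> x \<noteq> 0}"
      show "s \<in> {c 0..c n + h}"
      proof (rule ccontr)
        assume "s \<notin> {c 0..c n + h}"
        then consider "s < c 0" | "s > c n + h" by force
        then have "\<phi> s = 0"
        proof cases
          case 1
          have "R (s - c k) = 0" if "k \<le> n" for k
            unfolding R_def using 1 cmono[of 0 k] that by (intro smooth_step_left d) auto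
          then show ?thesis by (simp add: \<phi>_def)
        next
          case 2
          have "R (s - c k) = (h - d) / h" if "k \<le> n" for k
            unfolding R_def using 2 cmono[of k n] that by (intro smooth_step_right d) auto
          then show ?thesis by (simp add: \<phi>_def)
        qed
        with s show False by simp
      qed
    qed
    then have "closure {x. \<phi> x \<noteq> 0} \<subseteq> {c 0..c n + h}" by (intro closure_minimal) auto
    also have "\<dots> \<subseteq> {a<..<b}" using \<open>a < c 0\<close> \<open>c n + h < b\<close> by auto
    finally show "closure {x. \<phi> x \<noteq> 0} \<subseteq> {a<..<b}" .
  qed
  moreover have "\<bar>\<phi> s\<bar> \<le> 1" for s
  proof -
    have "\<bar>\<phi> s\<bar> \<le> (\<Sum>k<n. \<bar>\<sigma> k * (R (s - c k) - R (s - c (Suc k)))\<bar>)"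
      unfolding \<phi>_def by (rule sum_abs)
    also have "\<dots> \<le> (\<Sum>k<n. R (s - c k) - R (s - c (Suc k)))"
    proof (rule sum_mono)
      fix k assume "k \<in> {..<n}"
      then have "0 \<le> R (s - c k) - R (s - c (Suc k))"
        using smooth_step_mono[OF d, of "s - c (Suc k)" "s - c k"] c[of k] by (simp add: R_def)
      then show "\<bar>\<sigma> k * (R (s - c k) - R (s - c (Suc k)))\<bar> \<le> R (s - c k) - R (s - c (Suc k))"
        using \<sigma>[of k] by (simp add: abs_mult mult_left_le_one_le)
    qed
    also have "\<dots> = R (s - c 0) - R (s - c n)"
      using sum_lessThan_telescope'[of "\<lambda>k. R (s - c k)" n] by simp
    also have "\<dots> \<le> 1"
      using smooth_step_range[OF d] unfolding R_def by (smt (verit, best))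
    finally show ?thesis .
  qed
  ultimately have "integral\<^sup>L (lebesgue_on {a<..<b}) (\<lambda>x. \<alpha> x * \<phi>' x) \<le> V"
    using V deriv by metis
  moreover have "integral\<^sup>L (lebesgue_on {a<..<b}) (\<lambda>x. \<alpha> x * \<phi>' x) = (\<Sum>k<n. \<sigma> k * (I (c k) - I (c (Suc k))))"
  proof -
    have int: "integrable (lebesgue_on {a<..<b}) (\<lambda>s. \<alpha> s * trapezoid h d (s - x))" for x
    proof (rule Bochner_Integration.integrable_bound[OF integrable_mult_right[OF \<alpha>, of "1 / h"]])
      have "(\<lambda>s. trapezoid h d (s - x)) \<in> borel_measurable (lebesgue_on {a<..<b})"
        by (intro continuous_imp_measurable_on_sets_lebesgue continuous_on_subset[OF tcont]) auto
      then show "(\<lambda>s. \<alpha> s * trapezoid h d (s - x)) \<in> borel_measurable (lebesgue_on {a<..<b})"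
        using \<alpha> by (intro borel_measurable_times) auto
      show "AE s in lebesgue_on {a<..<b}. norm (\<alpha> s * trapezoid h d (s - x)) \<le> norm (1 / h * \<alpha> s)"
      proof (rule AE_I2)
        fix s
        show "norm (\<alpha> s * trapezoid h d (s - x)) \<le> norm (1 / h * \<alpha> s)"
          using trapezoid_bounds[OF d, of "s - x"] h mult_left_mono[of "trapezoid h d (s - x)" "1 / h" "\<bar>\<alpha> s\<bar>"]
          by (simp add: abs_mult)
      qed
    qed
    have "(\<lambda>x. \<alpha> x * \<phi>' x) = (\<lambda>s. \<Sum>k<n. \<sigma> k * (\<alpha> s * trapezoid h d (s - c k) - \<alpha> s * trapezoid h d (s - c (Suc k))))"
      by (auto simp: \<phi>'_def sum_distrib_left algebra_simps intro!: ext sum.cong)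
    then show ?thesis
      using int by (simp add: I_def)
  qed
  ultimately show ?thesis by simp
qed

text \<open>
  The limit \<open>d \<rightarrow> 0\<close> of the preceding bound, by dominated convergence.
\<close>

lemma averaged_chain_sum_le:
  fixes c :: "nat \<Rightarrow> real"
  assumes \<alpha>: "integrable (lebesgue_on {a<..<b}) \<alpha>"
    and V: "\<And>\<phi>. \<lbrakk>\<phi> \<in> C1_compact_support a b; \<And>x. \<bar>\<phi> x\<bar> \<le> 1\<rbrakk>
    \<Longrightarrow> integral\<^sup>L (lebesgue_on {a<..<b}) (\<lambda>x. \<alpha> x * deriv \<phi> x) \<le> V"
    and c: "\<And>k. k < n \<Longrightarrow> c k \<le> c (Suc k)" and "a < c 0" "c n + h < b" and h: "0 < h"
    and \<sigma>: "\<And>k. \<bar>\<sigma> k\<bar> \<le> (1::real)"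
  defines "A \<equiv> (\<lambda>x. integral (cbox x (x + h)) (\<lambda>s. if s \<in> {a<..<b} then \<alpha> s else 0) / h)"
  shows "(\<Sum>k<n. \<sigma> k * (A (c k) - A (c (Suc k)))) \<le> V"
proof -
  define d where "d = (\<lambda>j::nat. h / (real j + 2))"
  have d: "0 < d j" "2 * d j \<le> h" for j using h by (auto simp: d_def field_simps)
  have "d \<longlonglongrightarrow> 0" unfolding d_def by real_asymp
  then have dlim: "filterlim d (at_right 0) sequentially"
    using d(1) by (intro tendsto_imp_filterlim_at_right) auto
  define I where "I = (\<lambda>j x. integral\<^sup>L (lebesgue_on {a<..<b}) (\<lambda>s. \<alpha> s * trapezoid h (d j) (s - x)))"
  have lim: "(\<lambda>j. I j x) \<longlonglongrightarrow> A x" for x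
  proof -
    let ?g = "\<lambda>s. \<alpha> s * (indicator {0<..<h} (s - x) / h)"
    have meas: "(\<lambda>s. \<alpha> s * trapezoid h (d j) (s - x)) \<in> borel_measurable (lebesgue_on {a<..<b})" for j
    proof -
      have "(\<lambda>s. trapezoid h (d j) (s - x)) \<in> borel_measurable (lebesgue_on {a<..<b})"
        using h d(1)[of j] unfolding trapezoid_def
        by (intro continuous_imp_measurable_on_sets_lebesgue continuous_intros) auto
      then show ?thesis
        using \<alpha> by (intro borel_measurable_times) auto
    qed
    have bnd: "norm (\<alpha> s * trapezoid h (d j) (s - x)) \<le> \<bar>\<alpha> s\<bar> / h" for s j
      using trapezoid_bounds[OF d, of j "s - x"] mult_left_mono[of "trapezoid h (d j) (s - x)" "1 / h" "\<bar>\<alpha> s\<bar>"]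
      by (simp add: abs_mult)
    have ptw: "(\<lambda>j. \<alpha> s * trapezoid h (d j) (s - x)) \<longlonglongrightarrow> ?g s" for s
      by (intro tendsto_mult tendsto_const filterlim_compose[OF trapezoid_tendsto dlim] h)
    have gm: "?g \<in> borel_measurable (lebesgue_on {a<..<b})"
      using ptw by (intro borel_measurable_LIMSEQ_real[OF _ meas])
    have L: "(\<lambda>j. I j x) \<longlonglongrightarrow> integral\<^sup>L (lebesgue_on {a<..<b}) ?g"
      unfolding I_def
      by (rule integral_dominated_convergence[where w = "\<lambda>s. \<bar>\<alpha> s\<bar> / h"])
         (use gm meas ptw bnd \<alpha> in auto)
    have "integrable (lebesgue_on {a<..<b}) ?g"
      by (rule Bochner_Integration.integrable_bound[OF integrable_mult_right[OF \<alpha>, of "1 / h"] gm])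
         (use h in \<open>auto simp: indicator_def\<close>)
    then have "integral\<^sup>L (lebesgue_on {a<..<b}) ?g = integral {a<..<b} ?g"
      by (intro lebesgue_integral_eq_integral) auto
    also have "\<dots> = integral UNIV (\<lambda>s. if s \<in> {a<..<b} then ?g s else 0)"
      by (simp only: integral_restrict_UNIV)
    also have "(\<lambda>s. if s \<in> {a<..<b} then ?g s else 0) 
        = (\<lambda>s. if s \<in> {x<..<x + h} then (if s \<in> {a<..<b} then \<alpha> s else 0) / h else 0)"
      by (auto simp: indicator_def fun_eq_iff)
    also have "integral UNIV \<dots> = integral {x<..<x + h} (\<lambda>s. (if s \<in> {a<..<b} then \<alpha> s else 0) / h)"
      by (simp only: integral_restrict_UNIV)
    also have "\<dots> = A x"
      by (simp add: A_def integral_open_interval_real del: greaterThanLessThan_iff)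
    finally show ?thesis using L by simp
  qed
  have "(\<lambda>j. \<Sum>k<n. \<sigma> k * (I j (c k) - I j (c (Suc k)))) \<longlonglongrightarrow> (\<Sum>k<n. \<sigma> k * (A (c k) - A (c (Suc k))))"
    by (intro tendsto_intros lim)
  moreover have "(\<Sum>k<n. \<sigma> k * (I j (c k) - I j (c (Suc k)))) \<le> V" for j
    unfolding I_def by (rule smoothed_chain_sum_le) (fact \<alpha> V c \<open>a < c 0\<close> \<open>c n + h < b\<close> d \<sigma>)+
  ultimately show ?thesis by (intro LIMSEQ_le_const2) auto
qed

text \<open>
  At Lebesgue points the one-sided averages converge to \<open>\<alpha>\<close>, so the averaged bound passes to the limit
  \<open>h \<rightarrow> 0\<close>; the signs \<open>\<sigma> k\<close> of the differences turn the weighted sum into the variation along the chain.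
\<close>

lemma bounded_variation_imp_chain_sums_bounded:
  assumes "bounded_variation a b \<alpha>"
  obtains N V where "negligible N"
    "\<And>n c. \<lbrakk>\<And>k. k < n \<Longrightarrow> c k \<le> c (Suc k); \<And>k. k \<le> n \<Longrightarrow> c k \<in> {a<..<b} - N\<rbrakk>
        \<Longrightarrow> (\<Sum>k<n. \<bar>\<alpha> (c (Suc k)) - \<alpha> (c k)\<bar>) \<le> V"
proof -
  have \<alpha>: "integrable (lebesgue_on {a<..<b}) \<alpha>"
    using assms by (simp add: bounded_variation_def)
  obtain V where V: "\<And>\<phi>. \<lbrakk>\<phi> \<in> C1_compact_support a b; \<And>x. \<bar>\<phi> x\<bar> \<le> 1\<rbrakk>
    \<Longrightarrow> integral\<^sup>L (lebesgue_on {a<..<b}) (\<lambda>x. \<alpha> x * deriv \<phi> x) \<le> V"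
    using bounded_variation_test_bound[OF assms] by blast
  define f where "f = (\<lambda>s. if s \<in> {a<..<b} then \<alpha> s else 0)"
  have "\<alpha> integrable_on {a<..<b}"
    using \<alpha> by (simp add: integrable_on_lebesgue_on)
  then have "f integrable_on UNIV"
    unfolding f_def by (simp only: integrable_restrict_UNIV)
  then have fint: "f integrable_on cbox x y" for x y
    by (rule integrable_on_subcbox) auto
  define A where "A = (\<lambda>h x. integral (cbox x (x + h)) f / h)"
  obtain N where N: "negligible N"
    and "\<And>x e. \<lbrakk>x \<notin> N; 0 < e\<rbrakk> \<Longrightarrow> \<exists>d>0. \<forall>h. 0 < h \<and> h < d \<longrightarrow>
               norm (integral (cbox x (x + h *\<^sub>R One)) f /\<^sub>R h ^ DIM(real) - f x) < e"
    using integrable_ccontinuous_explicit[of f] fint by blast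
  then have leb: "\<exists>d>0. \<forall>h. 0 < h \<and> h < d \<longrightarrow> \<bar>A h x - f x\<bar> < e" if "x \<notin> N" "0 < e" for x e
    using that by (simp add: A_def divide_inverse mult.commute)
  have lim: "((\<lambda>h. A h x) \<longlongrightarrow> \<alpha> x) (at_right 0)" if x: "x \<in> {a<..<b} - N" for x
  proof (rule tendstoI)
    fix e :: real assume "0 < e"
    then obtain d where "d > 0" and d: "\<And>h. \<lbrakk>0 < h; h < d\<rbrakk> \<Longrightarrow> \<bar>A h x - f x\<bar> < e"
      using leb[of x e] x by blast
    show "\<forall>\<^sub>F h in at_right 0. dist (A h x) (\<alpha> x) < e"
      using eventually_at_right_real[OF \<open>d > 0\<close>]
      by eventually_elim (use d x in \<open>auto simp: dist_real_def f_def\<close>)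
  qed
  have "(\<Sum>k<n. \<bar>\<alpha> (c (Suc k)) - \<alpha> (c k)\<bar>) \<le> V"
    if c: "\<And>k. k < n \<Longrightarrow> c k \<le> c (Suc k)" "\<And>k. k \<le> n \<Longrightarrow> c k \<in> {a<..<b} - N" for n c
  proof -
    define \<sigma> where "\<sigma> = (\<lambda>k. sgn (\<alpha> (c k) - \<alpha> (c (Suc k))))"
    have "((\<lambda>h. \<Sum>k<n. \<sigma> k * (A h (c k) - A h (c (Suc k)))) \<longlongrightarrow>
        (\<Sum>k<n. \<sigma> k * (\<alpha> (c k) - \<alpha> (c (Suc k))))) (at_right 0)"
      by (intro tendsto_intros lim c) auto
    moreover have "\<forall>\<^sub>F h in at_right 0. (\<Sum>k<n. \<sigma> k * (A h (c k) - A h (c (Suc k)))) \<le> V"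
    proof -
      have "0 < b - c n" "a < c 0" using c(2)[of n] c(2)[of 0] by auto
      from eventually_at_right_real[OF this(1)] show ?thesis
      proof eventually_elim
        case (elim h)
        then show ?case
          using averaged_chain_sum_le[OF \<alpha> V c(1) \<open>a < c 0\<close>, of n h \<sigma>]
          by (simp add: A_def f_def \<sigma>_def abs_sgn_eq)
      qed
    qed
    ultimately have "(\<Sum>k<n. \<sigma> k * (\<alpha> (c k) - \<alpha> (c (Suc k)))) \<le> V"
      by (rule tendsto_upperbound) simp
    moreover have "\<sigma> k * (\<alpha> (c k) - \<alpha> (c (Suc k))) = \<bar>\<alpha> (c (Suc k)) - \<alpha> (c k)\<bar>" for k
      by (simp add: \<sigma>_def abs_minus_commute mult.commute[of "sgn _"] abs_sgn[symmetric])
    ultimately show ?thesis by simp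
  qed
  with N that show ?thesis by blast
qed

text \<open>
  The potential at \<open>x\<close> is the supremum of the sums over chains that end at \<open>x\<close>; appending \<open>y\<close> to such a
  chain gives the growth estimate.
\<close>

lemma chain_sum_potential:
  fixes r :: "real \<Rightarrow> real \<Rightarrow> real"
  assumes V: "\<And>n c. \<lbrakk>\<And>k. k < n \<Longrightarrow> c k \<le> c (Suc k); \<And>k. k \<le> n \<Longrightarrow> c k \<in> G\<rbrakk>
        \<Longrightarrow> (\<Sum>k<n. r (c k) (c (Suc k))) \<le> V"
  shows "\<exists>v. (\<forall>x\<in>G. 0 \<le> v x \<and> v x \<le> V) \<and> (\<forall>x\<in>G. \<forall>y\<in>G. x \<le> y \<longrightarrow> v x + r x y \<le> v y)"
proof -
  define S where "S = (\<lambda>x. {(\<Sum>k<n. r (c k) (c (Suc k))) |n c.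
     (\<forall>k<n. c k \<le> c (Suc k)) \<and> (\<forall>k\<le>n. c k \<in> G) \<and> c n = x})"
  have 0: "0 \<in> S x" if "x \<in> G" for x
    \<comment> \<open>The chain consisting of \<open>x\<close> alone has no increments.\<close>
    unfolding S_def using that by (intro CollectI exI[of _ 0] exI[of _ "\<lambda>_. x"]) auto
  have le: "y \<le> V" if sS: "y \<in> S x" for x y
    using sS V unfolding S_def by blast
  have bdd: "bdd_above (S x)" for x using le by (meson bdd_above.I)
  have range: "0 \<le> Sup (S x) \<and> Sup (S x) \<le> V" if "x \<in> G" for x
  proof
    show "0 \<le> Sup (S x)" using cSup_upper[OF 0[OF that] bdd] .
    show "Sup (S x) \<le> V" using 0[OF that] le by (intro cSup_least) auto
  qed
  have incr: "Sup (S x) + r x y \<le> Sup (S y)" if xy: "x \<in> G" "y \<in> G" "x \<le> y" for x y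
  proof -
    have "s \<le> Sup (S y) - r x y" if sS: "s \<in> S x" for s
    proof -
      obtain n c where c: "\<forall>k<n. c k \<le> c (Suc k)" "\<forall>k\<le>n. c k \<in> G" "c n = x"
        and s: "s = (\<Sum>k<n. r (c k) (c (Suc k)))" using sS unfolding S_def by blast
      define c' where "c' = c(Suc n := y)"
      have "(\<Sum>k<Suc n. r (c' k) (c' (Suc k))) = s + r x y"
        using c(3) by (simp add: c'_def s)
      moreover have "(\<Sum>k<Suc n. r (c' k) (c' (Suc k))) \<in> S y"
        unfolding S_def using c xy
        by (intro CollectI exI[of _ "Suc n"] exI[of _ c']) (auto simp: c'_def less_Suc_eq le_Suc_eq)
      ultimately have "s + r x y \<le> Sup (S y)" using cSup_upper[OF _ bdd] by metis
      then show ?thesis by simp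
    qed
    then have "Sup (S x) \<le> Sup (S y) - r x y" using 0[OF xy(1)] by (intro cSup_least) auto
    then show ?thesis by simp
  qed
  show ?thesis
    using range incr by (intro exI[of _ "\<lambda>x. Sup (S x)"]) blast
qed

lemma matrix_vector_le_entries:
  fixes A :: "real ^ 'n ^ 'n"
  shows "norm (A *v w) \<le> (\<Sum>i\<in>UNIV. \<Sum>j\<in>UNIV. \<bar>A $ i $ j\<bar>) * norm w"
proof -
  have "norm (A *v w) \<le> onorm ((*v) A) * norm w" by (intro onorm matrix_vector_mul_bounded_linear)
  also have "\<dots> \<le> (\<Sum>i\<in>UNIV. \<Sum>j\<in>UNIV. \<bar>A $ i $ j\<bar>) * norm w"
    by (intro mult_right_mono onorm_le_matrix_component_sum) auto
  finally show ?thesis .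
qed

text \<open>
  One potential controls all entries: it is built from the sum of the moduli of the entries of \<open>H y - H x\<close>,
  which dominates the operator norm and whose chain sums are bounded entrywise.
\<close>

lemma matrix_bounded_variation_potential:
  fixes H :: "real \<Rightarrow> real ^ 'n ^ 'n"
  assumes "bounded_variation_matrix a b H"
  shows "\<exists>N v V. negligible N \<and> (\<forall>x\<in>{a<..<b} - N. 0 \<le> v x \<and> v x \<le> (V::real)) \<and>
     (\<forall>x\<in>{a<..<b} - N. \<forall>y\<in>{a<..<b} - N. x \<le> y \<longrightarrow>
        (\<forall>w. norm ((H x - H y) *v w) \<le> (v y - v x) * norm w))"
proof -
  define bound where "bound = (\<lambda>i j N V. \<forall>n c. (\<forall>k<n. c k \<le> c (Suc k)) \<longrightarrow> (\<forall>k\<le>n. c k \<in> {a<..<b} - N)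
        \<longrightarrow> (\<Sum>k<n. \<bar>H (c (Suc k)) $ i $ j - H (c k) $ i $ j\<bar>) \<le> V)"
  have "\<exists>N V. negligible N \<and> bound i j N V" for i j
  proof -
    have "bounded_variation a b (\<lambda>x. H x $ i $ j)"
      using assms by (simp add: bounded_variation_matrix_def)
    then show ?thesis
      unfolding bound_def by (rule bounded_variation_imp_chain_sums_bounded) blast
  qed
  then obtain N V where N: "\<And>i j. negligible (N i j)" and "\<And>i j. bound i j (N i j) (V i j)"
    by metis
  then have V: "(\<Sum>k<n. \<bar>H (c (Suc k)) $ i $ j - H (c k) $ i $ j\<bar>) \<le> V i j"
    if "\<And>k. k < n \<Longrightarrow> c k \<le> c (Suc k)" "\<And>k. k \<le> n \<Longrightarrow> c k \<in> {a<..<b} - N i j" for i j n c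
    using that unfolding bound_def by simp
  define M where "M = (\<Union>i. \<Union>j. N i j)"
  have M: "negligible M" unfolding M_def using N by (intro negligible_Union) auto
  define r where "r = (\<lambda>x y. \<Sum>i\<in>UNIV. \<Sum>j\<in>UNIV. \<bar>H y $ i $ j - H x $ i $ j\<bar>)"
  have sumV: "(\<Sum>k<n. r (c k) (c (Suc k))) \<le> (\<Sum>i\<in>UNIV. \<Sum>j\<in>UNIV. V i j)"
    if "\<And>k. k < n \<Longrightarrow> c k \<le> c (Suc k)" "\<And>k. k \<le> n \<Longrightarrow> c k \<in> {a<..<b} - M" for n c
  proof -
    have "(\<Sum>k<n. r (c k) (c (Suc k))) = (\<Sum>i\<in>UNIV. \<Sum>j\<in>UNIV. \<Sum>k<n. \<bar>H (c (Suc k)) $ i $ j - H (c k) $ i $ j\<bar>)"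
      unfolding r_def by (subst sum.swap, rule sum.cong[OF refl], subst sum.swap, simp)
    also have "\<dots> \<le> (\<Sum>i\<in>UNIV. \<Sum>j\<in>UNIV. V i j)"
      using that by (intro sum_mono V) (auto simp: M_def)
    finally show ?thesis .
  qed
  obtain v where v: "\<forall>x\<in>{a<..<b} - M. 0 \<le> v x \<and> v x \<le> (\<Sum>i\<in>UNIV. \<Sum>j\<in>UNIV. V i j)"
    "\<forall>x\<in>{a<..<b} - M. \<forall>y\<in>{a<..<b} - M. x \<le> y \<longrightarrow> v x + r x y \<le> v y"
    using chain_sum_potential[where G = "{a<..<b} - M" and r = r, OF sumV] by blast
  have "norm ((H x - H y) *v w) \<le> (v y - v x) * norm w"
    if "x \<in> {a<..<b} - M" "y \<in> {a<..<b} - M" "x \<le> y" for x y w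
  proof -
    have r: "r x y \<le> v y - v x" using v(2) that by (simp add: le_diff_eq add.commute)
    have "norm ((H x - H y) *v w) \<le> r x y * norm w"
      using matrix_vector_le_entries[of "H x - H y" w] by (simp add: r_def abs_minus_commute)
    also have "\<dots> \<le> (v y - v x) * norm w" using r by (rule mult_right_mono) simp
    finally show ?thesis .
  qed
  with M v(1) show ?thesis by blast
qed

section \<open>Inverses of coercive symmetric matrices\<close>

lemma coercive_imp_invertible:
  fixes A :: "real ^ 'n ^ 'n"
  assumes "0 < m" and A: "\<And>w. m * (norm w)\<^sup>2 \<le> w \<bullet> (A *v w)"
  shows "invertible A"
proof -
  have "w = 0" if "A *v w = 0" for w
    using A[of w] that \<open>0 < m\<close> by (simp add: mult_le_0_iff)
  then show ?thesis
    using invertible_left_inverse matrix_left_invertible_ker by blast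
qed

lemma matrix_inv_mult:
  fixes A :: "real ^ 'n ^ 'n"
  assumes "invertible A"
  shows matrix_inv_right: "A ** matrix_inv A = mat 1"
    and matrix_inv_left: "matrix_inv A ** A = mat 1"
proof -
  have "A ** matrix_inv A = mat 1 \<and> matrix_inv A ** A = mat 1"
    using someI_ex[OF assms[unfolded invertible_def]] unfolding matrix_inv_def .
  then show "A ** matrix_inv A = mat 1" "matrix_inv A ** A = mat 1" by auto
qed

lemma symmetric_matrix_inv:
  fixes A :: "real ^ 'n ^ 'n"
  assumes "invertible A" "transpose A = A"
  shows "transpose (matrix_inv A) = matrix_inv A"
proof -
  have "transpose (matrix_inv A) ** A = transpose (A ** matrix_inv A)"
    by (simp add: matrix_transpose_mul assms)
  also have "\<dots> = mat 1" by (simp add: matrix_inv_right assms)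
  finally have "transpose (matrix_inv A) ** A = mat 1" .
  then have "transpose (matrix_inv A) ** (A ** matrix_inv A) = matrix_inv A"
    by (simp add: matrix_mul_assoc)
  then show ?thesis by (simp add: matrix_inv_right assms)
qed

lemma symmetric_dot:
  fixes A :: "real ^ 'n ^ 'n"
  assumes "transpose A = A"
  shows "v \<bullet> (A *v w) = w \<bullet> (A *v v)"
  by (metis assms dot_lmul_matrix inner_commute transpose_matrix_vector)

text \<open>
  The pointwise properties of \<open>H x\<close> at almost every \<open>x\<close>. They make the form of the inverse equivalent to the
  squared norm, with constants depending on \<open>m\<close> and \<open>C\<close> only.
\<close>

locale coercive_matrix =
  fixes A :: "real ^ 'n ^ 'n" and m C :: real
  assumes symmetric: "transpose A = A" and m: "0 < m"
    and coercive: "\<And>w. m * (norm w)\<^sup>2 \<le> w \<bullet> (A *v w)"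
    and bounded: "\<And>w. norm (A *v w) \<le> C * norm w"
begin

abbreviation "B \<equiv> matrix_inv A"

lemma inv: "invertible A" using coercive_imp_invertible[OF m coercive] .

lemma A_B: "A *v (B *v w) = w" 
  by (simp add: matrix_vector_mul_assoc matrix_inv_right inv)

lemma B_A: "B *v (A *v w) = w" 
  by (simp add: matrix_vector_mul_assoc matrix_inv_left inv)

lemma B_symmetric: "transpose B = B"
  by (rule symmetric_matrix_inv[OF inv symmetric])

lemma norm_B: "norm (B *v w) \<le> norm w / m"
proof -
  have "m * (norm (B *v w))\<^sup>2 \<le> (B *v w) \<bullet> w" using coercive[of "B *v w"] by (simp add: A_B)
  also have "\<dots> \<le> norm (B *v w) * norm w" by (rule norm_cauchy_schwarz)
  finally have "norm (B *v w) * (m * norm (B *v w)) \<le> norm (B *v w) * norm w"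
    by (simp add: power2_eq_square algebra_simps)
  then have "m * norm (B *v w) \<le> norm w"
    by (cases "norm (B *v w) = 0") (auto simp: mult_le_cancel_left)
  then show ?thesis using m by (simp add: pos_le_divide_eq mult.commute)
qed

lemma B_lower: "m / C\<^sup>2 * (norm w)\<^sup>2 \<le> w \<bullet> (B *v w)"
proof (cases "w = 0")
  case False
  have nw: "norm w \<le> C * norm (B *v w)" using bounded[of "B *v w"] by (simp add: A_B)
  with False have C: "C \<noteq> 0" by auto
  have "(norm w)\<^sup>2 \<le> C\<^sup>2 * (norm (B *v w))\<^sup>2"
    using power_mono[OF nw norm_ge_zero, of 2] by (simp add: power_mult_distrib)
  then have "m * ((norm w)\<^sup>2 / C\<^sup>2) \<le> m * (norm (B *v w))\<^sup>2"
    using m C by (intro mult_left_mono) (auto simp: pos_divide_le_eq mult.commute)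
  also have "\<dots> \<le> (B *v w) \<bullet> w" using coercive[of "B *v w"] by (simp add: A_B)
  finally show ?thesis by (simp add: inner_commute)
qed simp

end

text \<open>
  By the resolvent identity \<open>A2\<^sup>-\<^sup>1 - A1\<^sup>-\<^sup>1 = A2\<^sup>-\<^sup>1 (A1 - A2) A1\<^sup>-\<^sup>1\<close> the two forms differ by at most
  \<open>r \<parallel>w\<parallel>\<^sup>2 / m\<^sup>2\<close>, which the lower bound for \<open>A1\<^sup>-\<^sup>1\<close> turns into a relative error; \<open>1 + K r \<le> exp (K r)\<close>
  makes the comparison multiplicative along a chain of matrices.
\<close>

lemma inverse_form_comparison:
  fixes A1 A2 :: "real ^ 'n ^ 'n"
  assumes "coercive_matrix A1 m C" "coercive_matrix A2 m C" "0 < C"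
    and r: "\<And>w. norm ((A1 - A2) *v w) \<le> r * norm w"
  shows "w \<bullet> (matrix_inv A2 *v w) \<le> exp (C\<^sup>2 / m ^ 3 * r) * (w \<bullet> (matrix_inv A1 *v w))"
proof -
  interpret A1: coercive_matrix A1 m C by fact
  interpret A2: coercive_matrix A2 m C by fact
  let ?B1 = "matrix_inv A1" and ?B2 = "matrix_inv A2"
  have m: "0 < m" by (rule A1.m)
  have r0: "0 \<le> r" using order_trans[OF norm_ge_zero r[of "axis undefined 1"]] by simp
  have "?B2 *v ((A1 - A2) *v (?B1 *v w)) = ?B2 *v w - ?B1 *v w"
    by (simp add: matrix_vector_mult_diff_rdistrib matrix_vector_mult_diff_distrib A1.A_B A2.B_A)
  then have "w \<bullet> (?B2 *v w) - w \<bullet> (?B1 *v w) = w \<bullet> (?B2 *v ((A1 - A2) *v (?B1 *v w)))"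
    by (simp add: inner_diff_right)
  also have "\<dots> = ((A1 - A2) *v (?B1 *v w)) \<bullet> (?B2 *v w)"
    by (rule symmetric_dot[OF A2.B_symmetric])
  also have "\<dots> \<le> norm ((A1 - A2) *v (?B1 *v w)) * norm (?B2 *v w)" by (rule norm_cauchy_schwarz)
  also have "\<dots> \<le> (r * (norm w / m)) * (norm w / m)"
    using order_trans[OF r mult_left_mono[OF A1.norm_B r0]] A2.norm_B[of w] r0 m
    by (intro mult_mono) auto
  also have "\<dots> = (C\<^sup>2 / m ^ 3 * r) * (m / C\<^sup>2 * (norm w)\<^sup>2)"
    using m \<open>0 < C\<close> by (simp add: field_simps power2_eq_square power3_eq_cube)
  also have "\<dots> \<le> (C\<^sup>2 / m ^ 3 * r) * (w \<bullet> (?B1 *v w))"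
    using A1.B_lower[of w] m r0 by (intro mult_left_mono) auto
  finally have "w \<bullet> (?B2 *v w) \<le> (1 + C\<^sup>2 / m ^ 3 * r) * (w \<bullet> (?B1 *v w))"
    by (simp add: algebra_simps)
  also have "\<dots> \<le> exp (C\<^sup>2 / m ^ 3 * r) * (w \<bullet> (?B1 *v w))"
  proof (intro mult_right_mono exp_ge_add_one_self)
    have "0 \<le> m / C\<^sup>2 * (norm w)\<^sup>2" using m by simp
    then show "0 \<le> w \<bullet> (?B1 *v w)" using A1.B_lower[of w] by linarith
  qed
  finally show ?thesis .
qed

section \<open>The energy of a solution\<close>

text \<open>
  A complex vector \<open>p + i q\<close> is represented by the pair \<open>(p, q)\<close> of its real and imaginary parts, on which a
  real matrix acts componentwise. The real part of the Hermitian product becomes the inner product of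
  pairs.
\<close>

definition pair_map :: "real ^ 'n ^ 'n \<Rightarrow> (real ^ 'n) \<times> (real ^ 'n) \<Rightarrow> (real ^ 'n) \<times> (real ^ 'n)" where
  "pair_map T w = (T *v fst w, T *v snd w)"

lemma pair_map_linear: "bounded_linear (pair_map T)"
  by (intro linear_conv_bounded_linear[THEN iffD1] linearI)
     (auto simp: pair_map_def matrix_vector_right_distrib scaleR_matrix_vector_assoc
        matrix_vector_mult_scaleR)

lemma norm_pair_map_le:
  assumes "\<And>w. norm (T *v w) \<le> k * norm w" "0 \<le> k"
  shows "norm (pair_map T w) \<le> k * norm w"
proof -
  have "(norm (pair_map T w))\<^sup>2 = (norm (T *v fst w))\<^sup>2 + (norm (T *v snd w))\<^sup>2"
    by (simp add: pair_map_def norm_prod_def)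
  also have "\<dots> \<le> (k * norm (fst w))\<^sup>2 + (k * norm (snd w))\<^sup>2"
    by (intro add_mono power_mono assms) auto
  also have "\<dots> = (k * norm w)\<^sup>2"
    by (cases w) (simp add: norm_prod_def power_mult_distrib algebra_simps)
  finally show ?thesis using \<open>0 \<le> k\<close> by (simp add: power2_le_iff_abs_le)
qed

lemma pair_map_symmetric:
  assumes "transpose T = T"
  shows "v \<bullet> pair_map T w = w \<bullet> pair_map T v"
  using symmetric_dot[OF assms] by (simp add: pair_map_def inner_prod_def)

text \<open>
  The pair on the left is the right-hand side of \<open>u' = R (i t T u) - P u\<close> in real and imaginary parts. The
  two terms with the factor \<open>t\<close> are \<open>- (R T q) \<bullet> (T p)\<close> and \<open>(R T p) \<bullet> (T q)\<close>, which cancel because \<open>R\<close> is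
  symmetric; this is the only place where the parameter \<open>t\<close> could have entered the estimate.
\<close>

lemma hyperbolic_energy_bound:
  fixes P R T :: "real ^ 'n ^ 'n"
  assumes symR: "transpose R = R" and symT: "transpose T = T"
    and P: "\<And>w. norm (P *v w) \<le> \<beta> * norm w" and T: "\<And>w. norm (T *v w) \<le> \<gamma> * norm w"
    and "0 \<le> \<beta>" "0 \<le> \<gamma>"
  shows "(- t *\<^sub>R (R *v (T *v snd z)) - P *v fst z, t *\<^sub>R (R *v (T *v fst z)) - P *v snd z) \<bullet> pair_map T z
    \<le> \<beta> * \<gamma> * (norm z)\<^sup>2"
proof -
  let ?p = "fst z" and ?q = "snd z"
  have "(R *v (T *v ?q)) \<bullet> (T *v ?p) = (R *v (T *v ?p)) \<bullet> (T *v ?q)"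
    using symmetric_dot[OF symR] by (metis inner_commute)
  then have "(- t *\<^sub>R (R *v (T *v ?q)) - P *v ?p, t *\<^sub>R (R *v (T *v ?p)) - P *v ?q) \<bullet> pair_map T z
     = (- pair_map P z) \<bullet> pair_map T z"
    by (simp add: pair_map_def inner_prod_def algebra_simps inner_diff_left)
  also have "\<dots> \<le> norm (- pair_map P z) * norm (pair_map T z)" by (rule norm_cauchy_schwarz)
  also have "\<dots> \<le> (\<beta> * norm z) * (\<gamma> * norm z)"
    using norm_pair_map_le[OF P, of z] norm_pair_map_le[OF T, of z] assms(5,6)
    by (intro mult_mono) auto
  finally show ?thesis by (simp add: power2_eq_square mult_ac)
qed

definition energy :: "real ^ 'n ^ 'n \<Rightarrow> (real ^ 'n) \<times> (real ^ 'n) \<Rightarrow> real" where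
  "energy T w = w \<bullet> pair_map T w"

lemma energy_Pair: "energy T w = fst w \<bullet> (T *v fst w) + snd w \<bullet> (T *v snd w)"
  by (simp add: energy_def pair_map_def inner_prod_def)

lemma norm_sq_pair: "(norm w)\<^sup>2 = (norm (fst w))\<^sup>2 + (norm (snd w))\<^sup>2"
  by (cases w) (simp add: norm_prod_def)

context coercive_matrix
begin

lemma norm_pair_B: "norm (pair_map B w) \<le> norm w / m"
  using norm_pair_map_le[of B "1 / m" w] norm_B m by simp

lemma energy_lower: "m / C\<^sup>2 * (norm w)\<^sup>2 \<le> energy B w"
  unfolding energy_Pair norm_sq_pair distrib_left by (intro add_mono B_lower)

lemma energy_upper: "energy B w \<le> 1 / m * (norm w)\<^sup>2"
proof -
  have "energy B w \<le> norm w * norm (pair_map B w)"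
    unfolding energy_def by (rule norm_cauchy_schwarz)
  also have "\<dots> \<le> norm w * (norm w / m)" by (intro mult_left_mono norm_pair_B) auto
  finally show ?thesis by (simp add: power2_eq_square)
qed

lemma energy_lipschitz: "energy B w - energy B w' \<le> 1 / m * (norm w + norm w') * norm (w - w')"
proof -
  interpret L: bounded_linear "pair_map B" by (rule pair_map_linear)
  have "energy B w - energy B w' = (w + w') \<bullet> pair_map B (w - w')"
    unfolding energy_def L.diff inner_add_left inner_diff_right
    using pair_map_symmetric[OF B_symmetric, of w w'] by simp
  also have "\<dots> \<le> norm (w + w') * norm (pair_map B (w - w'))" by (rule norm_cauchy_schwarz)
  also have "\<dots> \<le> (norm w + norm w') * (norm (w - w') / m)"
    by (intro mult_mono norm_pair_B norm_triangle_ineq) auto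
  finally show ?thesis by simp
qed

end

lemma energy_has_derivative:
  assumes "transpose T = T" and z: "(z has_vector_derivative z') (at x)"
  shows "((\<lambda>s. energy T (z s)) has_real_derivative 2 * (z' \<bullet> pair_map T (z x))) (at x)"
proof -
  have "((\<lambda>s. pair_map T (z s)) has_vector_derivative pair_map T z') (at x)"
    by (rule bounded_linear.has_vector_derivative[OF pair_map_linear z])
  then have "((\<lambda>s. z s \<bullet> pair_map T (z s)) has_vector_derivative (z x \<bullet> pair_map T z' + z' \<bullet> pair_map T (z x))) (at x)"
    using bounded_bilinear.has_vector_derivative[OF bounded_bilinear_inner z] by blast
  then show ?thesis
    unfolding energy_def has_real_derivative_iff_has_vector_derivative
    using pair_map_symmetric[OF assms(1), of "z x" z'] by simp
qed

section \<open>Fundamental matrices\<close>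

definition column_parts :: "'n \<Rightarrow> complex ^ 'n ^ 'n \<Rightarrow> (real ^ 'n) \<times> (real ^ 'n)" where
  "column_parts j X = (\<chi> i. Re (X $ i $ j), \<chi> i. Im (X $ i $ j))"

lemma bounded_linear_column_parts: "bounded_linear (column_parts j)"
  by (intro linear_conv_bounded_linear[THEN iffD1] linearI)
     (auto simp: column_parts_def vec_eq_iff)

lemma norm_entry_le: "norm (X $ i $ j) \<le> 2 * norm (column_parts j X)"
proof -
  have "\<bar>Re (X $ i $ j)\<bar> \<le> norm (\<chi> i. Re (X $ i $ j))" "\<bar>Im (X $ i $ j)\<bar> \<le> norm (\<chi> i. Im (X $ i $ j))"
    using component_le_norm_cart[of "\<chi> i. Re (X $ i $ j)" i] component_le_norm_cart[of "\<chi> i. Im (X $ i $ j)" i] by auto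
  moreover have "norm (\<chi> i. Re (X $ i $ j)) \<le> norm (column_parts j X)" "norm (\<chi> i. Im (X $ i $ j)) \<le> norm (column_parts j X)"
    unfolding column_parts_def using norm_fst_le norm_snd_le by fast+
  ultimately show ?thesis using cmod_le[of "X $ i $ j"] by linarith
qed

lemma column_parts_mat_1: "norm (column_parts j (mat 1 :: complex ^ 'n ^ 'n)) = 1"
proof -
  have "column_parts j (mat 1 :: complex ^ 'n ^ 'n) = (axis j 1, 0)"
    by (auto simp: column_parts_def mat_def axis_def vec_eq_iff)
  then show ?thesis by (simp add: norm_Pair)
qed

text \<open>
  Each column of the fundamental matrix solves the system in the real form used by the energy estimate.
\<close>

lemma column_parts_ode_coeff:
  fixes X :: "complex ^ 'n ^ 'n" and P1 P0 :: "real ^ 'n ^ 'n" and H :: "real \<Rightarrow> real ^ 'n ^ 'n" and x t :: real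
  defines "R \<equiv> matrix_inv P1" and "T \<equiv> matrix_inv (H x)" 
  shows "column_parts j (ode_coeff P1 P0 H t x ** X) =
    (- t *\<^sub>R (R *v (T *v snd (column_parts j X))) - (R ** P0) *v fst (column_parts j X),
       t *\<^sub>R (R *v (T *v fst (column_parts j X))) - (R ** P0) *v snd (column_parts j X))"
proof -
  have entry: "ode_coeff P1 P0 H t x $ i $ k = Complex (- (R ** P0) $ i $ k) (t * (R ** T) $ i $ k)" for i k
    by (simp add: ode_coeff_def matrix_matrix_mult_def map_matrix_def complex_eq_iff R_def T_def
        sum_negf sum_distrib_left algebra_simps)
  have "column_parts j (ode_coeff P1 P0 H t x ** X) =
    (- t *\<^sub>R ((R ** T) *v snd (column_parts j X)) - (R ** P0) *v fst (column_parts j X),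
       t *\<^sub>R ((R ** T) *v fst (column_parts j X)) - (R ** P0) *v snd (column_parts j X))"
    by (simp add: column_parts_def vec_eq_iff matrix_vector_mult_def matrix_matrix_mult_def[of "ode_coeff _ _ _ _ _"] entry
        sum_negf sum_subtractf sum.distrib sum_distrib_left algebra_simps)
  then show ?thesis by (simp only: matrix_vector_mul_assoc)
qed

lemma onorm_le_entries:
  fixes X :: "complex ^ 'n ^ 'n"
  assumes "\<And>i j. norm (X $ i $ j) \<le> M"
  shows "onorm ((*v) X) \<le> real CARD('n) * (real CARD('n) * M)"
proof (rule onorm_bound)
  have M: "0 \<le> M" using order_trans[OF norm_ge_zero assms] .
  then show "0 \<le> real CARD('n) * (real CARD('n) * M)" by simp
  fix w :: "complex ^ 'n"
  have "norm (X *v w) \<le> (\<Sum>i\<in>UNIV. norm ((X *v w) $ i))" unfolding norm_vec_def[of "X *v w"] by (intro L2_set_le_sum) simp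
  also have "\<dots> \<le> (\<Sum>i\<in>(UNIV::'n set). \<Sum>j\<in>(UNIV::'n set). M * norm w)"
  proof (rule sum_mono)
    fix i
    have "norm ((X *v w) $ i) \<le> (\<Sum>j\<in>UNIV. norm (X $ i $ j * w $ j))"
      unfolding matrix_vector_mult_def by (simp add: norm_sum)
    also have "\<dots> \<le> (\<Sum>j\<in>(UNIV::'n set). M * norm w)"
      by (intro sum_mono) (auto simp: norm_mult intro!: mult_mono assms M Finite_Cartesian_Product.norm_nth_le)
    finally show "norm ((X *v w) $ i) \<le> (\<Sum>j\<in>(UNIV::'n set). M * norm w)" .
  qed
  finally show "norm (X *v w) \<le> real CARD('n) * (real CARD('n) * M) * norm w" by simp
qed

theorem theorem6p7:
  fixes a b m :: real
    and P\<^sub>1 P\<^sub>0 :: "real ^ 'n ^ 'n"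
    and H :: "real \<Rightarrow> real ^ 'n ^ 'n"
    and \<Phi> :: "real \<Rightarrow> real \<Rightarrow> complex ^ 'n ^ 'n"
  assumes "a < b"
    and "P\<^sub>1 = transpose P\<^sub>1" and "invertible P\<^sub>1"
    and "P\<^sub>0 = - transpose P\<^sub>0"
    and "Linf_matrix a b H"
    and "m > 0"
    and "AE x in lebesgue_on {a<..<b}. H x = transpose (H x) \<and> loewner_le (mat m) (H x)"
    and "\<And>t. fundamental_matrix a b (ode_coeff P\<^sub>1 P\<^sub>0 H t) (\<Phi> t)"
    and "bounded_variation_matrix a b H"
  shows "(SUP t. sup_norm a b (\<Phi> t)) < \<infinity>"
proof -
  obtain C0 where C0: "AE x in lebesgue_on {a<..<b}. onorm ((*v) (H x)) \<le> C0"
    using assms(5) unfolding Linf_matrix_def by blast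
  \<comment> \<open>Enlarging the essential bound gives \<open>0 < C\<close> and \<open>m \<le> C\<close>, so that the lower constant \<open>c\<close> below is at
    most the upper constant \<open>1 / m\<close>.\<close>
  define C where "C = max 1 (max m C0)"
  have C: "0 < C" "m \<le> C" "C0 \<le> C" by (auto simp: C_def)
  have "AE x in lebesgue_on {a<..<b}. coercive_matrix (H x) m C"
    using C0 assms(7)
  proof eventually_elim
    case (elim x)
    show ?case
    proof
      show "transpose (H x) = H x" using elim by simp
      show "m * (norm w)\<^sup>2 \<le> w \<bullet> (H x *v w)" for w
      proof -
        have "w \<bullet> (mat m *v w) \<le> w \<bullet> (H x *v w)" using elim unfolding loewner_le_def by blast
        moreover have "mat m *v w = m *\<^sub>R w"
          by (simp add: matrix_vector_mult_def mat_def vec_eq_iff if_distrib[where f="\<lambda>u. u * _"] cong: if_cong)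
        ultimately show ?thesis by (simp add: power2_norm_eq_inner)
      qed
      show "norm (H x *v w) \<le> C * norm w" for w
      proof -
        have "norm (H x *v w) \<le> onorm ((*v) (H x)) * norm w"
          by (intro onorm matrix_vector_mul_bounded_linear)
        also have "\<dots> \<le> C * norm w" using elim C(3) by (intro mult_right_mono) auto
        finally show ?thesis .
      qed
    qed (fact \<open>m > 0\<close>)
  qed
  then obtain N1 where N1: "negligible N1" "\<And>x. x \<in> {a<..<b} - N1 \<Longrightarrow> coercive_matrix (H x) m C"
    by (rule AE_lebesgue_on_negligible) auto
  obtain N2 v V where N2: "negligible N2"
    and v_range: "\<forall>x\<in>{a<..<b} - N2. 0 \<le> v x \<and> v x \<le> (V::real)"
    and v_diff: "\<forall>x\<in>{a<..<b} - N2. \<forall>y\<in>{a<..<b} - N2. x \<le> y \<longrightarrow>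
        (\<forall>w. norm ((H x - H y) *v w) \<le> (v y - v x) * norm w)"
    using matrix_bounded_variation_potential[OF assms(9)] by blast
  define T where "T = (\<lambda>x. matrix_inv (H x))"
  define R where "R = matrix_inv P\<^sub>1"
  have symR: "transpose R = R"
    unfolding R_def using symmetric_matrix_inv[OF assms(3)] assms(2) by simp
  define \<beta> where "\<beta> = onorm ((*v) (R ** P\<^sub>0))"
  have \<beta>: "norm ((R ** P\<^sub>0) *v w) \<le> \<beta> * norm w" "0 \<le> \<beta>" for w
    unfolding \<beta>_def by (intro onorm onorm_pos_le matrix_vector_mul_bounded_linear)+
  \<comment> \<open>\<open>K\<close> is the rate of \<open>inverse_form_comparison\<close>, and \<open>k\<close> bounds the contribution \<open>2 \<beta> \<parallel>z\<parallel>\<^sup>2 / m\<close> of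
    \<open>P\<^sub>0\<close> relative to the energy, which is at least \<open>(m / C\<^sup>2) \<parallel>z\<parallel>\<^sup>2\<close>.\<close>
  define K where "K = C\<^sup>2 / m ^ 3"
  have K: "0 \<le> K" using \<open>m > 0\<close> by (simp add: K_def)
  define k where "k = 2 * \<beta> * C\<^sup>2 / m\<^sup>2"
  have k: "0 \<le> k" using \<beta>(2) by (simp add: k_def)
  define c where "c = exp (- (K * max 0 V)) * (m / C\<^sup>2)"
  have c: "0 < c" using \<open>m > 0\<close> C by (simp add: c_def)
  have cC: "c \<le> 1 / m"
  proof -
    have "c \<le> 1 * (m / C\<^sup>2)" unfolding c_def using K \<open>m > 0\<close> by (intro mult_right_mono) auto
    also have "\<dots> \<le> 1 / m" using \<open>m > 0\<close> C power_mono[OF C(2), of 2]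
      by (simp add: field_simps power2_eq_square)
    finally show ?thesis .
  qed
  define q where "q = (\<lambda>x w. exp (- (K * v x)) * energy (T x) w)"
  have bound: "c * (norm (column_parts j (\<Phi> t x)))\<^sup>2 \<le> exp (k * (b - a)) * (1 / m)"
    if x: "x \<in> {a..b}" for t x and j :: 'n
  proof -
    define z where "z = (\<lambda>s. column_parts j (\<Phi> t s))"
    have fund: "abs_continuous_on a b (\<Phi> t)" "\<Phi> t a = mat 1"
      "AE x in lebesgue_on {a<..<b}. (\<Phi> t has_vector_derivative ode_coeff P\<^sub>1 P\<^sub>0 H t x ** \<Phi> t x) (at x)"
      using assms(8)[of t] unfolding fundamental_matrix_def by auto
    obtain N3 where N3: "negligible N3"
      "\<And>x. x \<in> {a<..<b} - N3 \<Longrightarrow> (\<Phi> t has_vector_derivative ode_coeff P\<^sub>1 P\<^sub>0 H t x ** \<Phi> t x) (at x)"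
      using AE_lebesgue_on_negligible[OF fund(3)] by auto
    define N where "N = N1 \<union> N2 \<union> N3"
    have "c * (norm (z x))\<^sup>2 \<le> exp (k * (b - a)) * (1 / m) * (norm (z a))\<^sup>2"
    proof (rule lyapunov_bound[where N = N and q = q, OF c cC k _ _ _ _ _ _ _ x])
      show "negligible N" using N1 N2 N3 by (simp add: N_def)
      show "abs_continuous_on a b z"
        unfolding z_def by (rule abs_continuous_on_bounded_linear[OF fund(1) bounded_linear_column_parts])
      fix y assume y: "y \<in> {a<..<b} - N"
      then have y1: "y \<in> {a<..<b} - N1" and y2: "y \<in> {a<..<b} - N2" and y3: "y \<in> {a<..<b} - N3"
        by (auto simp: N_def)
      interpret coercive_matrix "H y" m C by (rule N1(2)[OF y1])
      have E: "exp (- (K * max 0 V)) \<le> exp (- (K * v y))" "exp (- (K * v y)) \<le> 1"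
        using bspec[OF v_range y2] K by (auto intro!: mult_left_mono)
      show "c * (norm w)\<^sup>2 \<le> q y w" for w
      proof -
        have "c * (norm w)\<^sup>2 \<le> exp (- (K * v y)) * (m / C\<^sup>2 * (norm w)\<^sup>2)"
          unfolding c_def mult.assoc using E \<open>m > 0\<close> by (intro mult_right_mono) auto
        also have "\<dots> \<le> q y w"
          unfolding q_def T_def by (intro mult_left_mono energy_lower) auto
        finally show ?thesis .
      qed
      have scale: "exp (- (K * v y)) * r \<le> s" if "r \<le> s" "0 \<le> s" for r s
      proof -
        have "exp (- (K * v y)) * r \<le> exp (- (K * v y)) * s" using that by (intro mult_left_mono) auto
        also have "\<dots> \<le> s" using that E by (intro mult_left_le_one_le) auto
        finally show ?thesis .
      qed
      show "q y w \<le> 1 / m * (norm w)\<^sup>2" for w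
        unfolding q_def T_def using m by (intro scale energy_upper) auto
      show "q y w - q y w' \<le> 1 / m * (norm w + norm w') * norm (w - w')" for w w'
        unfolding q_def T_def right_diff_distrib[symmetric] using m by (intro scale energy_lipschitz) auto
      show "q y' w \<le> q y w" if "y' \<in> {a<..<b} - N" "y \<le> y'" for y' w
      proof -
        have y': "y' \<in> {a<..<b} - N1" "y' \<in> {a<..<b} - N2" using that by (auto simp: N_def)
        have "u \<bullet> (T y' *v u) \<le> exp (K * (v y' - v y)) * (u \<bullet> (T y *v u))" for u
          unfolding T_def K_def
          using v_diff y2 y'(2) that(2)
          by (intro inverse_form_comparison[OF N1(2)[OF y1] N1(2)[OF y'(1)] C(1)]) blast
        then have "energy (T y') w \<le> exp (K * (v y' - v y)) * energy (T y) w"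
          unfolding energy_Pair distrib_left by (intro add_mono)
        then have "q y' w \<le> exp (- (K * v y')) * (exp (K * (v y' - v y)) * energy (T y) w)"
          unfolding q_def by (intro mult_left_mono) auto
        also have "exp (- (K * v y')) * (exp (K * (v y' - v y)) * energy (T y) w) = q y w"
        proof -
          have "exp (- (K * v y')) * exp (K * (v y' - v y)) = exp (- (K * v y))"
            unfolding mult_exp_exp by (simp add: algebra_simps)
          then show ?thesis by (simp add: q_def mult.assoc[symmetric])
        qed
        finally show ?thesis .
      qed
      show "\<exists>D. ((\<lambda>s. q y (z s)) has_real_derivative D) (at y) \<and> D \<le> k * q y (z y)"
      proof -
        define z' where "z' = (- t *\<^sub>R (R *v (T y *v snd (z y))) - (R ** P\<^sub>0) *v fst (z y),
           t *\<^sub>R (R *v (T y *v fst (z y))) - (R ** P\<^sub>0) *v snd (z y))"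
        have "(z has_vector_derivative column_parts j (ode_coeff P\<^sub>1 P\<^sub>0 H t y ** \<Phi> t y)) (at y)"
          unfolding z_def
          by (rule bounded_linear.has_vector_derivative[OF bounded_linear_column_parts N3(2)[OF y3]])
        then have "(z has_vector_derivative z') (at y)"
          by (simp only: column_parts_ode_coeff z'_def z_def R_def T_def)
        then have "((\<lambda>s. energy (T y) (z s)) has_real_derivative 2 * (z' \<bullet> pair_map (T y) (z y))) (at y)"
          unfolding T_def by (rule energy_has_derivative[OF B_symmetric])
        then have D: "((\<lambda>s. q y (z s)) has_real_derivative exp (- (K * v y)) * (2 * (z' \<bullet> pair_map (T y) (z y)))) (at y)"
          unfolding q_def by (rule DERIV_cmult)
        have "z' \<bullet> pair_map (T y) (z y) \<le> \<beta> * (1 / m) * (norm (z y))\<^sup>2"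
          unfolding z'_def T_def
          by (rule hyperbolic_energy_bound[OF symR B_symmetric \<beta>(1) _ \<beta>(2)]) (use norm_B m in auto)
        also have "\<dots> = \<beta> * C\<^sup>2 / m\<^sup>2 * (m / C\<^sup>2 * (norm (z y))\<^sup>2)"
          using m C(1) by (simp add: field_simps power2_eq_square)
        also have "\<dots> \<le> \<beta> * C\<^sup>2 / m\<^sup>2 * energy (T y) (z y)"
          unfolding T_def using \<beta>(2) by (intro mult_left_mono energy_lower) auto
        finally have "2 * (z' \<bullet> pair_map (T y) (z y)) \<le> k * energy (T y) (z y)"
          by (simp add: k_def)
        then have "exp (- (K * v y)) * (2 * (z' \<bullet> pair_map (T y) (z y))) \<le> exp (- (K * v y)) * (k * energy (T y) (z y))"
          by (intro mult_left_mono) auto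
        with D show ?thesis by (auto simp: q_def mult_ac)
      qed
    qed
    moreover have "norm (z a) = 1" by (simp add: z_def fund(2) column_parts_mat_1)
    ultimately show ?thesis by (simp add: z_def)
  qed
  define M where "M = sqrt (exp (k * (b - a)) * (1 / m) / c)"
  have "norm (\<Phi> t x $ i $ j) \<le> 2 * M" if "x \<in> {a..b}" for t x i j
  proof -
    have "(norm (column_parts j (\<Phi> t x)))\<^sup>2 \<le> exp (k * (b - a)) * (1 / m) / c"
      using bound[OF that, of j t] unfolding pos_le_divide_eq[OF c] by (simp add: mult.commute)
    then have "norm (column_parts j (\<Phi> t x)) \<le> M"
      unfolding M_def by (rule real_le_rsqrt)
    then show ?thesis using norm_entry_le[of "\<Phi> t x" i j] by linarith
  qed
  then have "sup_norm a b (\<Phi> t) \<le> ereal (real CARD('n) * (real CARD('n) * (2 * M)))" for t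
    unfolding sup_norm_def by (intro SUP_least) (simp add: onorm_le_entries)
  then have "(SUP t. sup_norm a b (\<Phi> t)) \<le> ereal (real CARD('n) * (real CARD('n) * (2 * M)))"
    by (intro SUP_least)
  also have "\<dots> < \<infinity>" by simp
  finally show ?thesis .
qed

end
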